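(* In the setting below, let $(\varepsilon_N)\subset[0,\infty)$ with $\varepsilon_N\to0$, and let $(\bar u_N)$ be a sequence of random vectors with values in $\mathcal D(\psi)$ such that $\hat\Psi_N(\bar u_N)\le\varepsilon_N$ with probability one. Then (i) $\Psi(\bar u_N)\to0$ as $N\to\infty$ with probability one, and (ii) for almost all $\omega\in\Omega$, $(\bar u_N(\omega))$ has at least one weak accumulation point in $U$, and every such point is a zero of $\Psi$.
   Context: Let $U$ be a separable Hilbert space (identified with its dual, inner product $(\cdot,\cdot)_U$), $W$ a separable Banach space with dual $W^*$, and $B:U\to W$ a compact linear operator with adjoint $B^*:W^*\to U$. Let $\psi:U\to[0,\infty]$ be proper, closed and convex with bounded domain $\mathcal D(\psi)=\{u\in U:\psi(u)<\infty\}$. Let $U_0\subset U$ be open, convex and bounded with $\mathcal D(\psi)\subset U_0$. Let $\Xi$ be a complete separable metric space (with Borel $\sigma$-field), $\boldsymbol\xi$ a $\Xi$-valued random element, and $\boldsymbol\xi^1,\boldsymbol\xi^2,\ldots$ independent $\Xi$-valued random elements on a complete probability space $(\Omega,\mathcal F,P)$, each distributed as $\boldsymbol\xi$. Let $f:B(U_0)\times\Xi\to\mathbb R$ be such that $f(\cdot,\xi)$ is continuous on $B(\mathcal D(\psi))$ for each $\xi$, $f(w,\cdot)$ is measurable for each $w\in B(U_0)$, and $|f(Bu,\xi)|\le \zeta_f(\xi)$ for all $(u,\xi)\in U_0\times\Xi$ with $\zeta_f$ integrable. Assume further: for each $\xi$, $g_\xi:U_0\to\mathbb R$, $g_\xi(u)=f(Bu,\xi)$,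 is continuously differentiable; there is a Carathéodory map $\mathrm D_wf:B(\mathcal D(\psi))\times\Xi\to W^*$ with $\nabla g_\xi(u)=B^*\mathrm D_wf(Bu,\xi)$ for all $(u,\xi)\in\mathcal D(\psi)\times\Xi$; and there is an integrable $\zeta_{\mathrm Df}:\Xi\to[0,\infty)$ with $\|\nabla g_\xi(u)\|_U\le\zeta_{\mathrm Df}(\xi)$ on $U_0\times\Xi$ and $\|\mathrm D_wf(Bu,\xi)\|_{W^*}\le\zeta_{\mathrm Df}(\xi)$ on $\mathcal D(\psi)\times\Xi$. Define, for $w\in B(\mathcal D(\psi))$, $\mathrm DF(w)=\mathbb E[\mathrm D_wf(w,\boldsymbol\xi)]$ and $\mathrm D\hat F_N(w)=\frac1N\sum_{i=1}^N\mathrm D_wf(w,\boldsymbol\xi^i)$, and the gap functionals $\Psi,\hat\Psi_N:\mathcal D(\psi)\to[0,\infty]$, $\Psi(u)=\sup_{v\in\mathcal D(\psi)}[(B^*\mathrm DF(Bu),u-v)_U+\psi(u)-\psi(v)]$, $\hat\Psi_N(u)=\sup_{v\in\mathcal D(\psi)}[(B^*\mathrm D\hat F_N(Bu),u-v)_U+\psi(u)-\psi(v)]$. *)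

theory Defs
  imports "HOL-Probability.Probability"
begin

definition dom_fun :: "('u \<Rightarrow> ereal) \<Rightarrow> 'u set" where
  "dom_fun \<psi> = {u. \<psi> u < \<infinity>}"

definition closed_fun :: "('u::topological_space \<Rightarrow> ereal) \<Rightarrow> bool" where
  "closed_fun \<psi> \<longleftrightarrow> closed {(u, t::real). \<psi> u \<le> ereal t}"

definition convex_fun :: "('u::real_vector \<Rightarrow> ereal) \<Rightarrow> bool" where
  "convex_fun \<psi> \<longleftrightarrow> convex {(u, t::real). \<psi> u \<le> ereal t}"

definition proper_fun :: "('u \<Rightarrow> ereal) \<Rightarrow> bool" where
  "proper_fun \<psi> \<longleftrightarrow> (\<forall>u. \<psi> u \<noteq> -\<infinity>) \<and> dom_fun \<psi> \<noteq> {}"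

definition compact_operator :: "('u::real_normed_vector \<Rightarrow> 'w::real_normed_vector) \<Rightarrow> bool" where
  "compact_operator B \<longleftrightarrow> bounded_linear B \<and> compact (closure (B ` cball 0 1))"

text \<open>Expectation of a dual-space valued random element, taken weak-star (Gelfand):
  the functional z \<mapsto> E[G z].\<close>
definition dual_expectation :: "'a measure \<Rightarrow> ('a \<Rightarrow> ('w::real_normed_vector \<Rightarrow>\<^sub>L real)) \<Rightarrow> ('w \<Rightarrow>\<^sub>L real)" where
  "dual_expectation M G = Blinfun (\<lambda>z. \<integral>\<omega>. blinfun_apply (G \<omega>) z \<partial>M)"

text \<open>Gap functional: d is the gradient vector (here B^* DF(Bu) resp. B^* D\<hat>F_N(Bu)).\<close>
definition gap :: "('u::real_inner \<Rightarrow> ereal) \<Rightarrow> 'u \<Rightarrow> 'u \<Rightarrow> ereal" where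
  "gap \<psi> d u = (SUP v\<in>dom_fun \<psi>. ereal (inner d (u - v) + real_of_ereal (\<psi> u) - real_of_ereal (\<psi> v)))"

text \<open>Weak convergence in a Hilbert space (dual identified with the space via Riesz).\<close>
definition weakly_converges :: "(nat \<Rightarrow> 'u::real_inner) \<Rightarrow> 'u \<Rightarrow> bool" where
  "weakly_converges x u \<longleftrightarrow> (\<forall>v. (\<lambda>n. inner (x n) v) \<longlonglongrightarrow> inner u v)"

definition weak_accumulation_point :: "(nat \<Rightarrow> 'u::real_inner) \<Rightarrow> 'u \<Rightarrow> bool" where
  "weak_accumulation_point x u \<longleftrightarrow> (\<exists>r. strict_mono r \<and> weakly_converges (x \<circ> r) u)"

end

theory Submission
  imports Defs "HOL-Library.Diagonal_Subsequence"
begin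

text \<open>
  The bound on the empirical gap forces the iterates into a sublevel set of \<open>\<psi>\<close>, because the
  empirical gradients are almost surely bounded by the strong law of large numbers. Such a sublevel
  set is closed, convex and bounded, hence weakly sequentially compact, and the compact operator
  \<open>B\<close> maps it onto a norm-compact set.

  The gap functionals see the gradients only through the pairings \<open>D\<^sub>wf(w, \<xi>) z\<close> with \<open>w\<close> in this
  compact image and \<open>z\<close> in the compact closure of the image of the unit ball. A uniform law of large
  numbers for this real-valued integrand on a compact product suffices, so no
  integration or law of large numbers in the possibly non-separable dual space is needed; it makes
  the two gaps uniformly close. Zeros of the limiting gap then follow from weak lower
  semicontinuity of \<open>\<psi>\<close>.
\<close>

section \<open>The strong law of large numbers\<close>

text \<open>The iterates depend on the sample, so laws of large numbers at fixed points say nothing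
  about the empirical gradient at \<open>ubar N\<close>; uniformity over a compact set is what is
  missing. The image of the domain of \<psi> under \<open>B\<close> need not be compact, since that
  domain need not be closed, and \<open>Dwf\<close> is continuous only over it. Sublevel sets repair
  this, but the level that is reached depends on the outcome. Hence the uniform law is invoked for
  all natural levels, at the cost of a countable union of null sets. The second compact factor comes
  from the adjoint: \<open>inner (Bstar \<phi>) (u - v)\<close> equals
  \<open>\<phi> (B (u - v))\<close>, and \<open>u - v\<close> stays in a fixed ball because the
  domain is bounded. Randomness ends with these almost sure events; what remains concerns a single
  sequence and is stated in \<open>gap_consistency\<close>.\<close>

lemma (in prob_space) indep_sets_reindex:
  assumes "indep_sets F (f ` I)" "inj_on f I"
  shows "indep_sets (\<lambda>i. F (f i)) I"
  unfolding indep_sets_def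
proof (intro conjI ballI allI impI)
  show "F (f i) \<subseteq> events" if "i \<in> I" for i
    using assms(1) that by (auto simp: indep_sets_def)
  fix J A assume J: "J \<subseteq> I" "J \<noteq> {}" "finite J" and A: "A \<in> (\<Pi> j\<in>J. F (f j))"
  have inj: "inj_on f J" using assms(2) J(1) by (rule inj_on_subset)
  let ?A = "\<lambda>k. A (inv_into J f k)"
  have "prob (\<Inter>k\<in>f ` J. ?A k) = (\<Prod>k\<in>f ` J. prob (?A k))"
    using J A inj by (intro indep_setsD[OF assms(1)]) auto
  then show "prob (\<Inter>j\<in>J. A j) = (\<Prod>j\<in>J. prob (A j))"
    using inj by (simp add: prod.reindex)
qed

text \<open>The samples start at index 1 while the partial sums start at 0; the case
  \<open>f = Suc\<close> bridges the two and also supplies the shifted sequence of the maximal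
  argument.\<close>

lemma (in prob_space) indep_vars_reindex:
  assumes "indep_vars M' X (f ` I)" "inj_on f I"
  shows "indep_vars (\<lambda>i. M' (f i)) (\<lambda>i. X (f i)) I"
  using assms indep_sets_reindex[of "\<lambda>i. {X i -` A \<inter> space M | A. A \<in> sets (M' i)}" f I]
  by (auto simp: indep_vars_def2)

text \<open>Dropping the first \<open>m\<close> summands changes the partial sums by a bounded
  amount only, so boundedness is a tail event and Kolmogorov's law applies. The dichotomy later
  upgrades a mere failure of almost sure boundedness to almost sure unboundedness.\<close>

lemma (in prob_space) AE_bdd_above_zero_one:
  fixes X :: "nat \<Rightarrow> 'a \<Rightarrow> real"
  assumes indep: "indep_vars (\<lambda>_. borel) X UNIV"
  shows "(AE \<omega> in M. bdd_above (range (\<lambda>n. \<Sum>i<n. X i \<omega>))) \<or>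
         (AE \<omega> in M. \<not> bdd_above (range (\<lambda>n. \<Sum>i<n. X i \<omega>)))"
proof -
  have X[measurable]: "X i \<in> borel_measurable M" for i
    using indep by (auto simp: indep_vars_def)
  define A where "A i = sigma_sets (space M) {X i -` S \<inter> space M | S. S \<in> sets borel}" for i
  \<comment> \<open>Natural bounds make \<open>T\<close> a countable union of countable
    intersections, hence measurable.\<close>
  define T where "T = {\<omega> \<in> space M. \<exists>b::nat. \<forall>n. (\<Sum>i<n. X i \<omega>) \<le> real b}"
  have T_bdd: "\<omega> \<in> T \<longleftrightarrow> bdd_above (range (\<lambda>n. \<Sum>i<n. X i \<omega>))" if "\<omega> \<in> space M" for \<omega>
  proof
    assume "bdd_above (range (\<lambda>n. \<Sum>i<n. X i \<omega>))"
    then obtain c where "\<And>n. (\<Sum>i<n. X i \<omega>) \<le> c" by (auto simp: bdd_above_def)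
    then have "(\<Sum>i<n. X i \<omega>) \<le> real (nat \<lceil>c\<rceil>)" for n
      by (meson order_trans real_nat_ceiling_ge)
    then show "\<omega> \<in> T" using that by (auto simp: T_def)
  qed (auto simp: T_def bdd_above_def)
  have shift: "\<omega> \<in> T \<longleftrightarrow> (\<exists>b::nat. \<forall>k. (\<Sum>i<k. X (m + i) \<omega>) \<le> real b)" if "\<omega> \<in> space M" for \<omega> m
  proof -
    have split: "(\<Sum>i<m + k. X i \<omega>) = (\<Sum>i<m. X i \<omega>) + (\<Sum>i<k. X (m + i) \<omega>)" for k
      by (induction k) auto
    show ?thesis
    proof
      assume "\<omega> \<in> T"
      then obtain b :: nat where b: "\<And>n. (\<Sum>i<n. X i \<omega>) \<le> b" by (auto simp: T_def)
      have "(\<Sum>i<k. X (m + i) \<omega>) \<le> real (nat \<lceil>b - (\<Sum>i<m. X i \<omega>)\<rceil>)" for k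
        using b[of "m + k"] real_nat_ceiling_ge[of "b - (\<Sum>i<m. X i \<omega>)"] unfolding split by linarith
      then show "\<exists>b::nat. \<forall>k. (\<Sum>i<k. X (m + i) \<omega>) \<le> real b" by blast
    next
      assume "\<exists>b::nat. \<forall>k. (\<Sum>i<k. X (m + i) \<omega>) \<le> real b"
      then obtain b :: nat where b: "\<And>k. (\<Sum>i<k. X (m + i) \<omega>) \<le> b" by blast
      \<comment> \<open>Absolute values over the first \<open>m\<close> indices cover the short sums
        (\<open>n \<le> m\<close>) as well as the initial block of the long ones.\<close>
      have "(\<Sum>i<n. X i \<omega>) \<le> (\<Sum>i<m. \<bar>X i \<omega>\<bar>) + real b" for n
      proof (cases "n \<le> m")
        case True
        have "(\<Sum>i<n. X i \<omega>) \<le> (\<Sum>i<n. \<bar>X i \<omega>\<bar>)" by (intro sum_mono) auto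
        also have "\<dots> \<le> (\<Sum>i<m. \<bar>X i \<omega>\<bar>)" using True by (intro sum_mono2) auto
        finally show ?thesis by simp
      next
        case False
        then obtain k where "n = m + k" using le_Suc_ex nat_le_linear by blast
        moreover have "(\<Sum>i<m. X i \<omega>) \<le> (\<Sum>i<m. \<bar>X i \<omega>\<bar>)" by (intro sum_mono) auto
        ultimately show ?thesis using split[of k] b[of k] by simp
      qed
      then show "\<omega> \<in> T" unfolding T_bdd[OF that] by (auto simp: bdd_above_def)
    qed
  qed
  have "T \<in> tail_events A"
    unfolding tail_events_def
  proof
    fix m
    \<comment> \<open>Through \<open>shift\<close>, \<open>T\<close> is described by the variables
      of index at least \<open>m\<close>, each of them measurable for the sigma-algebra that they
      generate.\<close>
    let ?N = "sigma (space M) (\<Union> (A ` {m..}))"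
    have sub: "\<Union> (A ` {m..}) \<subseteq> Pow (space M)"
    proof clarify
      fix i S x assume S: "S \<in> A i" "x \<in> S"
      have "{X i -` S \<inter> space M | S. S \<in> sets borel} \<subseteq> Pow (space M)" by auto
      from sigma_sets_into_sp[OF this, of S] S show "x \<in> space M" unfolding A_def by blast
    qed
    have meas[measurable]: "X (m + i) \<in> borel_measurable ?N" for i
    proof (rule measurableI)
      fix S :: "real set" assume "S \<in> sets borel"
      then have "X (m + i) -` S \<inter> space M \<in> A (m + i)" unfolding A_def by auto
      then show "X (m + i) -` S \<inter> space ?N \<in> sets ?N"
        using sub by (auto simp: sets_measure_of space_measure_of intro!: sigma_sets.Basic bexI[of _ "m + i"])
    qed simp
    have "{\<omega> \<in> space ?N. \<exists>b::nat. \<forall>k. (\<Sum>i<k. X (m + i) \<omega>) \<le> real b} \<in> sets ?N"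
      by measurable
    also have "{\<omega> \<in> space ?N. \<exists>b::nat. \<forall>k. (\<Sum>i<k. X (m + i) \<omega>) \<le> real b} = T"
      using shift[of _ m] sub by (auto simp: space_measure_of T_def)
    finally show "T \<in> sigma_sets (space M) (\<Union> (A ` {m..}))"
      using sub by (simp add: sets_measure_of)
  qed
  moreover have "sigma_algebra (space M) (A i)" for i
    unfolding A_def by (rule sigma_algebra_sigma_sets) auto
  moreover have "indep_sets A UNIV"
    using indep unfolding indep_vars_def A_def by simp
  ultimately have "prob T = 0 \<or> prob T = 1"
    by (intro kolmogorov_0_1_law[of A])
  moreover have [measurable]: "T \<in> events" unfolding T_def by measurable
  ultimately have "(AE \<omega> in M. \<omega> \<in> T) \<or> (AE \<omega> in M. \<omega> \<notin> T)"
    by (metis prob_eq_0 prob_eq_1 \<open>T \<in> events\<close>)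
  moreover have "(AE \<omega> in M. \<omega> \<in> T) \<longleftrightarrow> (AE \<omega> in M. bdd_above (range (\<lambda>n. \<Sum>i<n. X i \<omega>)))"
    "(AE \<omega> in M. \<omega> \<notin> T) \<longleftrightarrow> (AE \<omega> in M. \<not> bdd_above (range (\<lambda>n. \<Sum>i<n. X i \<omega>)))"
    by (auto intro!: AE_cong simp: T_bdd)
  ultimately show ?thesis by auto
qed

section \<open>Maximal partial sums and Garsia's argument\<close>

text \<open>The recursion unfolds the first summand and so exposes the shift;
  the closed form is the maximum of the partial sums of length at most n.\<close>

fun max_psum :: "nat \<Rightarrow> (nat \<Rightarrow> real) \<Rightarrow> real" where
  "max_psum 0 Y = 0"
| "max_psum (Suc n) Y = max 0 (Y 0 + max_psum n (\<lambda>i. Y (Suc i)))"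

lemma max_psum_nonneg: "0 \<le> max_psum n Y"
  by (cases n) auto

lemma max_psum_mono: "max_psum n Y \<le> max_psum (Suc n) Y"
proof (induction n arbitrary: Y)
  case (Suc n)
  show ?case using Suc[of "\<lambda>i. Y (Suc i)"] by (auto simp: max_def)
qed simp

lemma psum_le_max_psum: "k \<le> n \<Longrightarrow> (\<Sum>i<k. Y i) \<le> max_psum n Y"
proof (induction n arbitrary: Y k)
  case (Suc n)
  show ?case
  proof (cases k)
    case (Suc j)
    then show ?thesis using Suc.IH[of j "\<lambda>i. Y (Suc i)"] Suc.prems
      by (simp add: sum.lessThan_Suc_shift del: sum.lessThan_Suc)
  qed (simp add: max_psum_nonneg)
qed simp

lemma max_psum_le: "max_psum n Y \<le> (\<Sum>i<n. \<bar>Y i\<bar>)"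
proof (induction n arbitrary: Y)
  case (Suc n)
  have "0 \<le> (\<Sum>i<n. \<bar>Y (Suc i)\<bar>)" by (simp add: sum_nonneg)
  then show ?case using Suc[of "\<lambda>i. Y (Suc i)"]
    by (simp add: sum.lessThan_Suc_shift del: sum.lessThan_Suc)
qed simp

lemma measurable_max_psum:
  assumes "\<And>i. (\<lambda>x. Y x i) \<in> borel_measurable M"
  shows "(\<lambda>x. max_psum n (Y x)) \<in> borel_measurable M"
  using assms
proof (induction n arbitrary: Y)
  case (Suc n)
  have [measurable]: "(\<lambda>x. max_psum n (\<lambda>i. Y x (Suc i))) \<in> borel_measurable M"
    using Suc.prems by (intro Suc.IH) auto
  have [measurable]: "(\<lambda>x. Y x 0) \<in> borel_measurable M" by fact
  show ?case by simp
qed simp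

lemma integrable_max_psum:
  assumes "\<And>i. integrable M (\<lambda>x. Y x i)"
  shows "integrable M (\<lambda>x. max_psum n (Y x))"
proof (rule Bochner_Integration.integrable_bound)
  show "integrable M (\<lambda>x. \<Sum>i<n. \<bar>Y x i\<bar>)"
    using assms by (intro Bochner_Integration.integrable_sum integrable_abs)
  show "(\<lambda>x. max_psum n (Y x)) \<in> borel_measurable M"
    using assms by (intro measurable_max_psum) auto
  show "AE x in M. norm (max_psum n (Y x)) \<le> norm (\<Sum>i<n. \<bar>Y x i\<bar>)"
  proof (rule AE_I2)
    fix x show "norm (max_psum n (Y x)) \<le> norm (\<Sum>i<n. \<bar>Y x i\<bar>)"
      using max_psum_nonneg[of n "Y x"] max_psum_le[of n "Y x"] by simp
  qed
qed

text \<open>Independence and equal marginals determine the law of the whole sequence as a product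
  measure, which the shifted sequence shares; \<open>max_psum n\<close> is a measurable functional
  on sequence space.\<close>

lemma (in prob_space) max_psum_shift_expectation:
  fixes X :: "nat \<Rightarrow> 'a \<Rightarrow> real"
  assumes indep: "indep_vars (\<lambda>_. borel) X UNIV"
    and same: "\<And>i. distr M borel (X i) = distr M borel (X 0)"
  shows "expectation (\<lambda>\<omega>. max_psum n (\<lambda>i. X (Suc i) \<omega>)) = expectation (\<lambda>\<omega>. max_psum n (\<lambda>i. X i \<omega>))"
proof -
  have X[measurable]: "X i \<in> borel_measurable M" for i
    using indep by (auto simp: indep_vars_def)
  have "indep_vars (\<lambda>_. borel) (\<lambda>i. X (Suc i)) UNIV"
    by (rule indep_vars_reindex[where f=Suc and X=X and M'="\<lambda>_. borel"])
       (auto intro: indep_vars_subset[OF indep])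
  then have "distr M (\<Pi>\<^sub>M i\<in>UNIV. borel) (\<lambda>\<omega>. \<lambda>i\<in>UNIV. X (Suc i) \<omega>) = (\<Pi>\<^sub>M i\<in>UNIV. distr M borel (X (Suc i)))"
    by (subst (asm) indep_vars_iff_distr_eq_PiM) auto
  also have "\<dots> = (\<Pi>\<^sub>M i\<in>UNIV. distr M borel (X i))"
    using same by (metis (no_types, lifting))
  also have "\<dots> = distr M (\<Pi>\<^sub>M i\<in>UNIV. borel) (\<lambda>\<omega>. \<lambda>i\<in>UNIV. X i \<omega>)"
    using indep by (subst (asm) indep_vars_iff_distr_eq_PiM) auto
  finally have eq: "distr M (\<Pi>\<^sub>M i\<in>UNIV. borel) (\<lambda>\<omega> i. X (Suc i) \<omega>) = distr M (\<Pi>\<^sub>M i\<in>UNIV. borel) (\<lambda>\<omega> i. X i \<omega>)"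
    by (simp add: restrict_def)
  have m: "max_psum n \<in> borel_measurable (\<Pi>\<^sub>M i\<in>(UNIV::nat set). borel)"
    by (rule measurable_max_psum) measurable
  have "(\<lambda>\<omega> i. X i \<omega>) \<in> measurable M (\<Pi>\<^sub>M i\<in>UNIV. borel)"
       "(\<lambda>\<omega> i. X (Suc i) \<omega>) \<in> measurable M (\<Pi>\<^sub>M i\<in>UNIV. borel)"
    by (auto intro!: measurable_PiM_single')
  from this[THEN integral_distr, OF m] show ?thesis
    unfolding eq by simp
qed

text \<open>Garsia's maximal argument: by stationarity
  \<open>0 \<le> E[M\<^sub>n\<^sub>+\<^sub>1 - M\<^sub>n] = E[max (- M\<^sub>n \<circ> shift) X\<^sub>0]\<close>, and the right-hand side
  would tend to \<open>E X\<^sub>0\<close> if the partial sums were unbounded above.\<close>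

lemma (in prob_space) AE_bdd_above_partial_sums:
  fixes X :: "nat \<Rightarrow> 'a \<Rightarrow> real"
  assumes indep: "indep_vars (\<lambda>_. borel) X UNIV"
    and same: "\<And>i. distr M borel (X i) = distr M borel (X 0)"
    and int: "integrable M (X 0)"
    and neg: "expectation (X 0) < 0"
  shows "AE \<omega> in M. bdd_above (range (\<lambda>n. \<Sum>i<n. X i \<omega>))"
proof (rule ccontr)
  assume "\<not> ?thesis"
  then have unb: "AE \<omega> in M. \<not> bdd_above (range (\<lambda>n. \<Sum>i<n. X i \<omega>))"
    using AE_bdd_above_zero_one[OF indep] by blast
  have X[measurable]: "X i \<in> borel_measurable M" for i
    using indep by (auto simp: indep_vars_def)
  have intX: "integrable M (X i)" for i
  proof -
    have "integrable (distr M borel (X 0)) (\<lambda>x. x)"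
      using int by (simp add: integrable_distr_eq)
    then have "integrable (distr M borel (X i)) (\<lambda>x. x)"
      unfolding same[of i] .
    then show ?thesis by (simp add: integrable_distr_eq)
  qed
  let ?M = "\<lambda>n \<omega>. max_psum n (\<lambda>i. X i \<omega>)"
  let ?S = "\<lambda>n \<omega>. max_psum n (\<lambda>i. X (Suc i) \<omega>)"
  have [measurable]: "?M n \<in> borel_measurable M" "?S n \<in> borel_measurable M" for n
    by (auto intro!: measurable_max_psum)
  have intM: "integrable M (?M n)" "integrable M (?S n)" for n
    using intX by (auto intro!: integrable_max_psum)
  have key: "?M (Suc n) \<omega> - ?S n \<omega> = max (- ?S n \<omega>) (X 0 \<omega>)" for n \<omega>
    by (auto simp: max_def)
  have "0 \<le> expectation (\<lambda>\<omega>. max (- ?S n \<omega>) (X 0 \<omega>))" for n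
  proof -
    have "0 \<le> expectation (?M (Suc n)) - expectation (?M n)"
      using intM max_psum_mono by (simp add: integral_mono del: max_psum.simps)
    also have "\<dots> = expectation (?M (Suc n)) - expectation (?S n)"
      using max_psum_shift_expectation[OF indep same] by simp
    also have "\<dots> = expectation (\<lambda>\<omega>. ?M (Suc n) \<omega> - ?S n \<omega>)"
      using intM by (simp del: max_psum.simps)
    finally show ?thesis unfolding key .
  qed
  moreover have "(\<lambda>n. expectation (\<lambda>\<omega>. max (- ?S n \<omega>) (X 0 \<omega>))) \<longlonglongrightarrow> expectation (X 0)"
  proof (rule integral_dominated_convergence[where w="\<lambda>\<omega>. \<bar>X 0 \<omega>\<bar>"])
    show "AE \<omega> in M. (\<lambda>n. max (- ?S n \<omega>) (X 0 \<omega>)) \<longlonglongrightarrow> X 0 \<omega>"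
      using unb
    proof eventually_elim
      fix \<omega> assume u: "\<not> bdd_above (range (\<lambda>n. \<Sum>i<n. X i \<omega>))"
      \<comment> \<open>Unboundedness survives the removal of \<open>X 0\<close>. Once a shifted sum
        exceeds \<open>- X 0 \<omega>\<close>, the maximum equals \<open>X 0 \<omega>\<close>
        exactly for all later \<open>n\<close>.\<close>
      have "\<exists>k. (\<Sum>i<k. X (Suc i) \<omega>) > - X 0 \<omega>"
      proof (rule ccontr)
        assume "\<not> ?thesis"
        then have *: "(\<Sum>i<k. X (Suc i) \<omega>) \<le> - X 0 \<omega>" for k by (auto simp: not_less)
        have "(\<Sum>i<n. X i \<omega>) \<le> 0" for n
          using *[of "n - 1"] by (cases n) (auto simp: sum.lessThan_Suc_shift simp del: sum.lessThan_Suc)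
        then show False using u by (auto simp: bdd_above_def)
      qed
      then obtain k where k: "(\<Sum>i<k. X (Suc i) \<omega>) > - X 0 \<omega>" by blast
      have "eventually (\<lambda>n. X 0 \<omega> = max (- ?S n \<omega>) (X 0 \<omega>)) sequentially"
        using eventually_ge_at_top[of k]
      proof eventually_elim
        case (elim n)
        then show ?case using k psum_le_max_psum[of k n "\<lambda>i. X (Suc i) \<omega>"] by (auto simp: max_def)
      qed
      then show "(\<lambda>n. max (- ?S n \<omega>) (X 0 \<omega>)) \<longlonglongrightarrow> X 0 \<omega>"
        by (rule Lim_transform_eventually[OF tendsto_const])
    qed
    \<comment> \<open>As \<open>?S n \<omega>\<close> is nonnegative, the maximum lies between
      \<open>X 0 \<omega>\<close> and \<open>max 0 (X 0 \<omega>)\<close>.\<close>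
    show "AE \<omega> in M. norm (max (- ?S n \<omega>) (X 0 \<omega>)) \<le> \<bar>X 0 \<omega>\<bar>" for n
    proof (rule AE_I2)
      fix \<omega> show "norm (max (- ?S n \<omega>) (X 0 \<omega>)) \<le> \<bar>X 0 \<omega>\<bar>"
        using max_psum_nonneg[of n "\<lambda>i. X (Suc i) \<omega>"] by (auto simp: max_def)
    qed
  qed (use int in auto)
  ultimately have "0 \<le> expectation (X 0)"
    by (intro LIMSEQ_le_const) auto
  then show False using neg by simp
qed

text \<open>Centring at a level \<open>d\<close> strictly between the mean and \<open>c\<close>
  gives summands of negative mean; a bound \<open>b\<close> on their partial sums leaves
  \<open>d + b / n\<close> for the average, which drops below \<open>c\<close>.\<close>

lemma (in prob_space) AE_eventually_average_less:
  fixes X :: "nat \<Rightarrow> 'a \<Rightarrow> real"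
  assumes indep: "indep_vars (\<lambda>_. borel) X UNIV"
    and same: "\<And>i. distr M borel (X i) = distr M borel (X 0)"
    and int: "integrable M (X 0)" and c: "expectation (X 0) < c"
  shows "AE \<omega> in M. eventually (\<lambda>n. (\<Sum>i<n. X i \<omega>) / n < c) sequentially"
proof -
  have X[measurable]: "X i \<in> borel_measurable M" for i
    using indep by (auto simp: indep_vars_def)
  obtain d where d: "expectation (X 0) < d" "d < c" using c dense by blast
  have "AE \<omega> in M. bdd_above (range (\<lambda>n. \<Sum>i<n. X i \<omega> - d))"
  proof (rule AE_bdd_above_partial_sums)
    show "indep_vars (\<lambda>_. borel) (\<lambda>i \<omega>. X i \<omega> - d) UNIV"
      using indep_vars_compose2[OF indep, of "\<lambda>_ x. x - d"] by simp
    have "distr M borel (\<lambda>\<omega>. X i \<omega> - d) = distr (distr M borel (X i)) borel (\<lambda>x. x - d)" for i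
      by (simp add: distr_distr comp_def)
    then show "distr M borel (\<lambda>\<omega>. X i \<omega> - d) = distr M borel (\<lambda>\<omega>. X 0 \<omega> - d)" for i
      using same[of i] by simp
  qed (use int d in \<open>simp_all add: prob_space\<close>)
  then show ?thesis
  proof eventually_elim
    fix \<omega> assume "bdd_above (range (\<lambda>n. \<Sum>i<n. X i \<omega> - d))"
    then obtain b where b: "(\<Sum>i<n. X i \<omega> - d) \<le> b" for n by (auto simp: bdd_above_def)
    have "(\<lambda>n. d + b / real n) \<longlonglongrightarrow> d + 0" by (intro tendsto_intros lim_const_over_n)
    then have "eventually (\<lambda>n. d + b / real n < c) sequentially"
      using d(2) by (intro order_tendstoD(2)) auto
    then show "eventually (\<lambda>n. (\<Sum>i<n. X i \<omega>) / n < c) sequentially"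
      using eventually_gt_at_top[of 0]
    proof eventually_elim
      case (elim n)
      have "(\<Sum>i<n. X i \<omega>) / n \<le> d + b / n"
        using b[of n] elim(2) by (simp add: sum_subtractf field_simps)
      then show ?case using elim(1) by linarith
    qed
  qed
qed

text \<open>The one-sided estimate for \<open>X\<close> and for its negative, with countably many
  tolerances, gives both halves of the limit.\<close>

theorem (in prob_space) strong_law_of_large_numbers:
  fixes X :: "nat \<Rightarrow> 'a \<Rightarrow> real"
  assumes indep: "indep_vars (\<lambda>_. borel) X UNIV"
    and same: "\<And>i. distr M borel (X i) = distr M borel (X 0)"
    and int: "integrable M (X 0)"
  shows "AE \<omega> in M. (\<lambda>n. (\<Sum>i<n. X i \<omega>) / n) \<longlonglongrightarrow> expectation (X 0)"
proof -
  have X[measurable]: "X i \<in> borel_measurable M" for i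
    using indep by (auto simp: indep_vars_def)
  let ?e = "\<lambda>k. inverse (real (Suc k))"
  have up: "AE \<omega> in M. \<forall>k. eventually (\<lambda>n. (\<Sum>i<n. X i \<omega>) / n < expectation (X 0) + ?e k) sequentially"
    using assms by (subst AE_all_countable) (auto intro!: AE_eventually_average_less)
  have "AE \<omega> in M. \<forall>k. eventually (\<lambda>n. (\<Sum>i<n. - X i \<omega>) / n < expectation (\<lambda>\<omega>. - X 0 \<omega>) + ?e k) sequentially"
  proof (subst AE_all_countable, intro allI AE_eventually_average_less)
    show "indep_vars (\<lambda>_. borel) (\<lambda>i \<omega>. - X i \<omega>) UNIV"
      using indep_vars_compose2[OF indep, of "\<lambda>_ x. - x"] by simp
    have "distr M borel (\<lambda>\<omega>. - X i \<omega>) = distr (distr M borel (X i)) borel (\<lambda>x. - x)" for i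
      by (simp add: distr_distr comp_def)
    then show "distr M borel (\<lambda>\<omega>. - X i \<omega>) = distr M borel (\<lambda>\<omega>. - X 0 \<omega>)" for i
      using same[of i] by simp
  qed (use int in auto)
  with up show ?thesis
  proof eventually_elim
    fix \<omega>
    assume u: "\<forall>k. eventually (\<lambda>n. (\<Sum>i<n. X i \<omega>) / n < expectation (X 0) + ?e k) sequentially"
      and l: "\<forall>k. eventually (\<lambda>n. (\<Sum>i<n. - X i \<omega>) / n < expectation (\<lambda>\<omega>. - X 0 \<omega>) + ?e k) sequentially"
    show "(\<lambda>n. (\<Sum>i<n. X i \<omega>) / n) \<longlonglongrightarrow> expectation (X 0)"
    proof (rule tendstoI)
      fix e :: real assume "0 < e"
      then obtain k where k: "?e k < e" using reals_Archimedean by blast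
      show "eventually (\<lambda>n. dist ((\<Sum>i<n. X i \<omega>) / n) (expectation (X 0)) < e) sequentially"
        using u[rule_format, of k] l[rule_format, of k]
        by eventually_elim (use k in \<open>auto simp: dist_real_def sum_negf abs_less_iff\<close>)
    qed
  qed
qed

section \<open>A uniform law of large numbers\<close>

lemma (in prob_space) strong_law_sample_average:
  fixes Z :: "nat \<Rightarrow> 'a \<Rightarrow> 'b" and h :: "'b \<Rightarrow> real"
  assumes indep: "indep_vars (\<lambda>_. S) Z {1..}"
    and distr: "\<And>i. i \<ge> 1 \<Longrightarrow> distr M S (Z i) = Q"
    and int: "integrable Q h"
  shows "AE \<omega> in M. (\<lambda>N. (1 / real N) * (\<Sum>i\<in>{1..N}. h (Z i \<omega>))) \<longlonglongrightarrow> (\<integral>x. h x \<partial>Q)"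
proof -
  have Z[measurable]: "Z (Suc i) \<in> M \<rightarrow>\<^sub>M S" for i
    using indep by (auto simp: indep_vars_def)
  have Q: "distr M S (Z (Suc i)) = Q" for i using distr[of "Suc i"] by simp
  have "sets Q = sets S" using Q[of 0] by (metis sets_distr)
  then have h[measurable]: "h \<in> borel_measurable S"
    using borel_measurable_integrable[OF int] by (simp cong: measurable_cong_sets)
  have "indep_vars (\<lambda>_. S) (\<lambda>i. Z (Suc i)) UNIV"
    by (rule indep_vars_reindex[where f=Suc and X=Z and M'="\<lambda>_. S"])
       (auto intro: indep_vars_subset[OF indep])
  then have ind: "indep_vars (\<lambda>_. borel) (\<lambda>i \<omega>. h (Z (Suc i) \<omega>)) UNIV"
    by (rule indep_vars_compose2) simp
  have "distr M borel (\<lambda>\<omega>. h (Z (Suc i) \<omega>)) = distr Q borel h" for i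
    using distr_distr[of h S borel "Z (Suc i)" M] Q[of i] by (simp add: comp_def)
  then have "AE \<omega> in M. (\<lambda>n. (\<Sum>i<n. h (Z (Suc i) \<omega>)) / n) \<longlonglongrightarrow> expectation (\<lambda>\<omega>. h (Z (Suc 0) \<omega>))"
    using integrable_distr_eq[OF Z[of 0] h] int Q[of 0] by (intro strong_law_of_large_numbers ind) auto
  moreover have "expectation (\<lambda>\<omega>. h (Z (Suc 0) \<omega>)) = (\<integral>x. h x \<partial>Q)"
    using integral_distr[OF Z[of 0] h] Q[of 0] by simp
  moreover have "(\<Sum>i\<in>{1..N}. h (Z i \<omega>)) = (\<Sum>i<N. h (Z (Suc i) \<omega>))" for N \<omega>
    by (rule sum.reindex_bij_witness[of _ Suc "\<lambda>i. i - 1"]) auto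
  ultimately show ?thesis by simp
qed

text \<open>Passes from pairs in the dense set to pairs with one point in it: the strict inequality
  \<open>dist k c < \<delta>\<close> persists along a sequence from \<open>C\<close> tending to
  \<open>k\<close>, and the non-strict bound survives the limit.\<close>

lemma dense_modulus_bound:
  fixes H :: "'k::metric_space \<Rightarrow> real"
  assumes cont: "continuous_on K H" and C: "C \<subseteq> K" "K \<subseteq> closure C"
    and bound: "\<And>a b. a \<in> C \<Longrightarrow> b \<in> C \<Longrightarrow> dist a b < \<delta> \<Longrightarrow> \<bar>H a - H b\<bar> \<le> m"
    and k: "k \<in> K" "c \<in> C" "dist k c < \<delta>"
  shows "\<bar>H k - H c\<bar> \<le> m"
proof -
  obtain x where x: "\<And>n. x n \<in> C" "x \<longlonglongrightarrow> k" using C(2) k(1) closure_sequential by blast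
  have "(\<lambda>n. H (x n)) \<longlonglongrightarrow> H k"
    using x(1) C(1) by (intro continuous_on_tendsto_compose[OF cont x(2) k(1)] always_eventually) auto
  then have "(\<lambda>n. \<bar>H (x n) - H c\<bar>) \<longlonglongrightarrow> \<bar>H k - H c\<bar>" by (intro tendsto_intros)
  moreover have "(\<lambda>n. dist (x n) c) \<longlonglongrightarrow> dist k c" using x(2) by (intro tendsto_intros)
  then have "eventually (\<lambda>n. dist (x n) c < \<delta>) sequentially" using k(3) by (intro order_tendstoD(2))
  then have "eventually (\<lambda>n. \<bar>H (x n) - H c\<bar> \<le> m) sequentially"
    by eventually_elim (use bound x(1) k(2) in blast)
  ultimately show ?thesis by (rule tendsto_upperbound) simp
qed

text \<open>The modulus of continuity over a countable dense subset is a measurable function whose mean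
  tends to zero with the scale, so the strong law need only be invoked countably often.\<close>

lemma (in prob_space) uniform_law_of_large_numbers:
  fixes Z :: "nat \<Rightarrow> 'a \<Rightarrow> 'b" and H :: "'k::{metric_space, second_countable_topology} \<Rightarrow> 'b \<Rightarrow> real"
  assumes indep: "indep_vars (\<lambda>_. S) Z {1..}"
    and distr: "\<And>i. i \<ge> 1 \<Longrightarrow> distr M S (Z i) = Q"
    and K: "compact K"
    and cont: "\<And>x. continuous_on K (\<lambda>k. H k x)"
    and meas: "\<And>k. k \<in> K \<Longrightarrow> H k \<in> borel_measurable Q"
    and bound: "\<And>k x. k \<in> K \<Longrightarrow> \<bar>H k x\<bar> \<le> \<zeta> x" and int: "integrable Q \<zeta>"
  shows "AE \<omega> in M. uniform_limit K (\<lambda>N k. (1 / real N) * (\<Sum>i\<in>{1..N}. H k (Z i \<omega>)))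
           (\<lambda>k. \<integral>x. H k x \<partial>Q) sequentially"
proof (cases "K = {}")
  case True
  then show ?thesis by (simp add: uniform_limit_iff)
next
  case False
  obtain C where C: "countable C" "C \<subseteq> K" "K \<subseteq> closure C" by (rule separable)
  then have Cne: "C \<noteq> {}" using False by auto
  define P where "P n = {p \<in> C \<times> C. dist (fst p) (snd p) < inverse (real (Suc n))}" for n
  define m where "m n x = (SUP p\<in>P n. \<bar>H (fst p) x - H (snd p) x\<bar>)" for n x
  have P_count: "countable (P n)" for n unfolding P_def using C(1) by (intro countable_subset[OF _ countable_SIGMA[of C "\<lambda>_. C"]]) auto
  have P_ne: "P n \<noteq> {}" for n
  proof -
    obtain c where "c \<in> C" using Cne by auto
    then have "(c, c) \<in> P n" by (auto simp: P_def)
    then show ?thesis by auto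
  qed
  have P_K: "fst p \<in> K" "snd p \<in> K" if "p \<in> P n" for p n using that C(2) by (auto simp: P_def)
  have diff: "\<bar>H (fst p) x - H (snd p) x\<bar> \<le> 2 * \<zeta> x" if "p \<in> P n" for p n x
    using bound[OF P_K(1)[OF that], of x] bound[OF P_K(2)[OF that], of x] by linarith
  have bdd: "bdd_above ((\<lambda>p. \<bar>H (fst p) x - H (snd p) x\<bar>) ` P n)" for n x
    using diff by (intro bdd_aboveI2[where M="2 * \<zeta> x"]) auto
  have m_ub: "m n x \<le> 2 * \<zeta> x" for n x
    unfolding m_def using P_ne diff by (intro cSUP_least) auto
  have m_ge: "\<bar>H a x - H b x\<bar> \<le> m n x"
    if "a \<in> C" "b \<in> C" "dist a b < inverse (real (Suc n))" for a b n x
    unfolding m_def using that cSUP_upper[OF _ bdd, of "(a, b)" n x] by (simp add: P_def)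
  have m_nonneg: "0 \<le> m n x" for n x
    using m_ge[of _ _ n x] Cne by (fastforce intro: order_trans[OF abs_ge_zero])
  have m_meas[measurable]: "m n \<in> borel_measurable Q" for n
    unfolding m_def
  proof (rule borel_measurable_cSUP[OF P_count])
    fix p assume p: "p \<in> P n"
    note [measurable] = meas[OF P_K(1)[OF p]] meas[OF P_K(2)[OF p]]
    show "(\<lambda>x. \<bar>H (fst p) x - H (snd p) x\<bar>) \<in> borel_measurable Q" by measurable
  qed (rule bdd)
  have m_lim: "(\<lambda>n. m n x) \<longlonglongrightarrow> 0" for x
  proof (rule tendstoI)
    fix e :: real assume "0 < e"
    then have "0 < e / 2" by simp
    have "uniformly_continuous_on K (\<lambda>k. H k x)" by (rule compact_uniformly_continuous[OF cont K])
    then obtain d where d: "0 < d" "\<And>a b. a \<in> K \<Longrightarrow> b \<in> K \<Longrightarrow> dist a b < d \<Longrightarrow> dist (H a x) (H b x) < e / 2"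
      unfolding uniformly_continuous_on_def using \<open>0 < e / 2\<close> by metis
    have "eventually (\<lambda>n. inverse (real (Suc n)) < d) sequentially"
      using LIMSEQ_inverse_real_of_nat d(1) by (rule order_tendstoD(2))
    then show "eventually (\<lambda>n. dist (m n x) 0 < e) sequentially"
    proof eventually_elim
      case (elim n)
      have "m n x \<le> e / 2"
        unfolding m_def
      proof (rule cSUP_least[OF P_ne])
        fix p assume p: "p \<in> P n"
        then have "dist (fst p) (snd p) < d" using elim by (auto simp: P_def)
        then show "\<bar>H (fst p) x - H (snd p) x\<bar> \<le> e / 2"
          using d(2)[OF P_K(1)[OF p] P_K(2)[OF p]] by (simp add: dist_real_def)
      qed
      then show ?case using m_nonneg[of n x] \<open>0 < e\<close> by simp
    qed
  qed
  have m_int: "integrable Q (m n)" for n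
  proof (rule Bochner_Integration.integrable_bound)
    show "integrable Q (\<lambda>x. 2 * \<zeta> x)" using int by simp
    show "AE x in Q. norm (m n x) \<le> norm (2 * \<zeta> x)"
    proof (rule AE_I2)
      fix x show "norm (m n x) \<le> norm (2 * \<zeta> x)" using m_ub[of n x] m_nonneg[of n x] by simp
    qed
  qed simp
  have H_int: "integrable Q (H k)" if "k \<in> K" for k
    using int meas[OF that]
  proof (rule Bochner_Integration.integrable_bound)
    show "AE x in Q. norm (H k x) \<le> norm (\<zeta> x)"
    proof (rule AE_I2)
      fix x show "norm (H k x) \<le> norm (\<zeta> x)" using bound[OF that, of x] by simp
    qed
  qed
  have Em_lim: "(\<lambda>n. \<integral>x. m n x \<partial>Q) \<longlonglongrightarrow> (\<integral>x. 0 \<partial>Q)"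
  proof (rule integral_dominated_convergence[where w="\<lambda>x. 2 * \<zeta> x"])
    show "AE x in Q. norm (m n x) \<le> 2 * \<zeta> x" for n using m_ub m_nonneg by simp
  qed (use int m_lim in auto)
  let ?A = "\<lambda>h N \<omega>. (1 / real N) * (\<Sum>i\<in>{1..N}. h (Z i \<omega>))"
  have A_diff: "\<bar>?A g N \<omega> - ?A h N \<omega>\<bar> \<le> ?A b N \<omega>" if "\<And>x. \<bar>g x - h x\<bar> \<le> b x" for g h b :: "'b \<Rightarrow> real" and N \<omega>
  proof -
    have "?A g N \<omega> - ?A h N \<omega> = (1 / real N) * (\<Sum>i\<in>{1..N}. g (Z i \<omega>) - h (Z i \<omega>))"
      by (simp add: sum_subtractf diff_divide_distrib)
    also have "\<bar>\<dots>\<bar> \<le> (1 / real N) * (\<Sum>i\<in>{1..N}. \<bar>g (Z i \<omega>) - h (Z i \<omega>)\<bar>)"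
      by (simp add: abs_mult divide_right_mono)
    also have "\<dots> \<le> ?A b N \<omega>" using that by (intro mult_left_mono sum_mono) auto
    finally show ?thesis .
  qed
  have "AE \<omega> in M. \<forall>n. (\<lambda>N. ?A (m n) N \<omega>) \<longlonglongrightarrow> (\<integral>x. m n x \<partial>Q)"
    unfolding AE_all_countable using strong_law_sample_average[OF indep distr m_int] by blast
  moreover have "AE \<omega> in M. \<forall>c\<in>C. (\<lambda>N. ?A (H c) N \<omega>) \<longlonglongrightarrow> (\<integral>x. H c x \<partial>Q)"
    using strong_law_sample_average[OF indep distr H_int] C(2)
    by (subst AE_ball_countable[OF C(1)]) blast
  ultimately show ?thesis
  proof eventually_elim
    fix \<omega>
    assume Am: "\<forall>n. (\<lambda>N. ?A (m n) N \<omega>) \<longlonglongrightarrow> (\<integral>x. m n x \<partial>Q)"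
      and AH: "\<forall>c\<in>C. (\<lambda>N. ?A (H c) N \<omega>) \<longlonglongrightarrow> (\<integral>x. H c x \<partial>Q)"
    show "uniform_limit K (\<lambda>N k. ?A (H k) N \<omega>) (\<lambda>k. \<integral>x. H k x \<partial>Q) sequentially"
      unfolding uniform_limit_iff
    proof (intro allI impI)
      fix e :: real assume "0 < e"
      \<comment> \<open>The error splits into thirds: the deviation at a net point, the sample
        average of the modulus, and its expectation. The scale \<open>n\<close> is fixed before
        \<open>N\<close>, so one finite net serves all large \<open>N\<close>.\<close>
      then have "eventually (\<lambda>n. (\<integral>x. m n x \<partial>Q) < e / 3) sequentially"
        using Em_lim by (intro order_tendstoD(2)) auto
      then obtain n where n: "(\<integral>x. m n x \<partial>Q) < e / 3" using eventually_happens trivial_limit_sequentially by blast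
      let ?d = "inverse (real (Suc n))"
      have "K \<subseteq> (\<Union>c\<in>C. ball c ?d)"
      proof
        fix k assume "k \<in> K"
        then have "k \<in> closure C" using C(3) by blast
        moreover have "0 < ?d" by simp
        ultimately obtain c where "c \<in> C" "dist c k < ?d" unfolding closure_approachable by blast
        then show "k \<in> (\<Union>c\<in>C. ball c ?d)" by auto
      qed
      \<comment> \<open>The centres come from the countable set \<open>C\<close>, where the strong
        law already holds at this outcome.\<close>
      then obtain F where F: "F \<subseteq> C" "finite F" "K \<subseteq> (\<Union>c\<in>F. ball c ?d)"
        using compactE_image[OF K, of C "\<lambda>c. ball c ?d"] by auto
      have "eventually (\<lambda>N. \<forall>c\<in>F. dist (?A (H c) N \<omega>) (\<integral>x. H c x \<partial>Q) < e / 3) sequentially"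
        using F(1,2) AH \<open>0 < e\<close> by (intro eventually_ball_finite ballI tendstoD) auto
      moreover have "eventually (\<lambda>N. ?A (m n) N \<omega> < e / 3) sequentially"
        using Am n by (intro order_tendstoD(2)) auto
      ultimately show "eventually (\<lambda>N. \<forall>k\<in>K. dist (?A (H k) N \<omega>) (\<integral>x. H k x \<partial>Q) < e) sequentially"
      proof eventually_elim
        case (elim N)
        show ?case
        proof
          fix k assume k: "k \<in> K"
          then obtain c where c: "c \<in> F" "dist k c < ?d" using F(3) by (auto simp: dist_commute)
          then have cK: "c \<in> C" "c \<in> K" using F(1) C(2) by auto
          have Hkc: "\<bar>H k x - H c x\<bar> \<le> m n x" for x
            by (rule dense_modulus_bound[OF cont C(2,3) m_ge k cK(1) c(2)])
          have "\<bar>?A (H k) N \<omega> - ?A (H c) N \<omega>\<bar> \<le> ?A (m n) N \<omega>"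
            using Hkc by (rule A_diff)
          moreover have "\<bar>(\<integral>x. H k x \<partial>Q) - (\<integral>x. H c x \<partial>Q)\<bar> \<le> (\<integral>x. m n x \<partial>Q)"
          proof -
            have "(\<integral>x. H k x \<partial>Q) - (\<integral>x. H c x \<partial>Q) = (\<integral>x. H k x - H c x \<partial>Q)"
              using H_int[OF k] H_int[OF cK(2)] by simp
            also have "\<bar>\<dots>\<bar> \<le> (\<integral>x. \<bar>H k x - H c x\<bar> \<partial>Q)" by (rule integral_abs_bound)
            also have "\<dots> \<le> (\<integral>x. m n x \<partial>Q)"
              using Hkc H_int[OF k] H_int[OF cK(2)] m_int by (intro integral_mono) auto
            finally show ?thesis .
          qed
          moreover have "dist (?A (H c) N \<omega>) (\<integral>x. H c x \<partial>Q) < e / 3" using elim(1) c(1) by blast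
          ultimately show "dist (?A (H k) N \<omega>) (\<integral>x. H k x \<partial>Q) < e"
            using elim(2) n unfolding dist_real_def by linarith
        qed
      qed
    qed
  qed
qed

section \<open>Weak convergence in Hilbert spaces\<close>

lemma parallelogram_midpoint:
  fixes a b :: "'a::real_inner"
  shows "(norm (a - b))\<^sup>2 = 2 * (norm a)\<^sup>2 + 2 * (norm b)\<^sup>2 - 4 * (norm ((1/2) *\<^sub>R (a + b)))\<^sup>2"
  by (simp add: power2_norm_eq_inner inner_commute algebra_simps)

text \<open>Almost norm-minimal elements of a decreasing sequence of convex sets form a Cauchy
  sequence, by the parallelogram law.\<close>

lemma nested_closed_convex_bounded_Inter_nonempty:
  fixes C :: "nat \<Rightarrow> 'a::{real_inner, complete_space} set"
  assumes closed: "\<And>n. closed (C n)" and convex: "\<And>n. convex (C n)" and ne: "\<And>n. C n \<noteq> {}"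
    and dec: "decseq C" and bdd: "bounded (C 0)"
  shows "(\<Inter>n. C n) \<noteq> {}"
proof -
  \<comment> \<open>Squares fit the parallelogram law; \<open>q\<close> is nondecreasing because the
    sets shrink, and it is bounded because \<open>C 0\<close> is.\<close>
  define q where "q n = (INF x\<in>C n. (norm x)\<^sup>2)" for n
  have bb: "bdd_below ((\<lambda>x. (norm x)\<^sup>2) ` C n)" for n
    by (rule bdd_belowI2[of _ 0]) auto
  have q_le: "q n \<le> (norm x)\<^sup>2" if "x \<in> C n" for x n
    unfolding q_def using that bb by (intro cINF_lower)
  have sub: "C m \<subseteq> C n" if "n \<le> m" for m n using dec that by (auto simp: decseq_def)
  have q_mono: "q n \<le> q m" if "n \<le> m" for m n
    unfolding q_def[of m] using ne q_le sub[OF that] by (intro cINF_greatest) auto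
  obtain R where R: "\<And>x. x \<in> C 0 \<Longrightarrow> norm x \<le> R" using bdd by (auto simp: bounded_iff)
  have "q n \<le> R\<^sup>2" for n
  proof -
    obtain x where x: "x \<in> C n" using ne by auto
    then have "norm x \<le> R" using sub[of 0 n] R by auto
    then have "(norm x)\<^sup>2 \<le> R\<^sup>2" by (intro power_mono) auto
    then show ?thesis using q_le[OF x] by linarith
  qed
  then obtain L where L: "q \<longlonglongrightarrow> L" and L_ge: "\<And>n. q n \<le> L"
    using incseq_convergent[of q "R\<^sup>2"] q_mono by (auto simp: incseq_def)
  have "\<exists>x\<in>C n. (norm x)\<^sup>2 < q n + inverse (real (Suc n))" for n
    using cINF_less_iff[OF ne bb, of n "q n + inverse (real (Suc n))"] unfolding q_def[symmetric] by simp
  then obtain p where p: "\<And>n. p n \<in> C n" "\<And>n. (norm (p n))\<^sup>2 < q n + inverse (real (Suc n))"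
    by metis
  \<comment> \<open>Both points lie in \<open>C n\<close>, hence so does their midpoint, whose
    squared norm is at least \<open>q n\<close>; the squared norms of the two points stay within
    their slack of \<open>q n\<close> and of \<open>q m \<le> L\<close>.\<close>
  have est: "(norm (p n - p m))\<^sup>2 \<le> 4 * (L - q n) + 4 * inverse (real (Suc n))" if "n \<le> m" for n m
  proof -
    have "(1/2) *\<^sub>R p n + (1/2) *\<^sub>R p m \<in> C n"
      using p(1)[of n] p(1)[of m] sub[OF that] by (intro convexD[OF convex]) auto
    then have "q n \<le> (norm ((1/2) *\<^sub>R (p n + p m)))\<^sup>2"
      by (intro q_le) (simp add: scaleR_add_right)
    moreover have "inverse (real (Suc m)) \<le> inverse (real (Suc n))" using that by (intro le_imp_inverse_le) auto
    moreover have "2 * a + 2 * b - 4 * c \<le> 4 * (L - q n) + 4 * s"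
      if "q n \<le> c" "t \<le> s" "a < q n + s" "b < q m + t" for a b c s t
      using that L_ge[of m] L_ge[of n] by argo
    ultimately show ?thesis
      using p(2)[of n] p(2)[of m] unfolding parallelogram_midpoint by blast
  qed
  have "(\<lambda>n. 4 * (L - q n) + 4 * inverse (real (Suc n))) \<longlonglongrightarrow> 4 * (L - L) + 4 * 0"
    by (intro tendsto_intros L LIMSEQ_inverse_real_of_nat)
  then have lim0: "(\<lambda>n. 4 * (L - q n) + 4 * inverse (real (Suc n))) \<longlonglongrightarrow> 0" by simp
  have "Cauchy p"
  proof (rule CauchyI')
    fix e :: real assume "0 < e"
    then have "eventually (\<lambda>n. 4 * (L - q n) + 4 * inverse (real (Suc n)) < e\<^sup>2) sequentially"
      using lim0 by (intro order_tendstoD(2)) auto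
    then obtain n0 where n0: "4 * (L - q n) + 4 * inverse (real (Suc n)) < e\<^sup>2" if "n \<ge> n0" for n
      by (auto simp: eventually_sequentially)
    have "norm (p m - p n) < e" if "m \<ge> n0" "n > m" for m n
    proof -
      have "(norm (p m - p n))\<^sup>2 < e\<^sup>2"
        using est[of m n] n0[of m] that by auto
      then show ?thesis using \<open>0 < e\<close> by (simp add: power_less_imp_less_base)
    qed
    then show "\<exists>M. \<forall>m\<ge>M. \<forall>n>m. dist (p m) (p n) < e" by (auto simp: dist_norm)
  qed
  then obtain l where l: "p \<longlonglongrightarrow> l" using Cauchy_convergent_iff convergent_def by blast
  have "l \<in> C n" for n
  proof (rule Lim_in_closed_set[OF closed _ _ l])
    show "eventually (\<lambda>m. p m \<in> C n) sequentially"
      using eventually_ge_at_top[of n] by eventually_elim (use p(1) sub in blast)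
  qed auto
  then show ?thesis by blast
qed

text \<open>The vectors whose pairing with \<open>v\<close> is within \<open>e\<close> of
  \<open>l\<close> form a closed convex slab.\<close>

lemma inner_convex_hull_dist:
  fixes x :: "'i \<Rightarrow> 'a::real_inner"
  assumes "\<And>i. i \<in> I \<Longrightarrow> \<bar>inner (x i) v - l\<bar> \<le> e" "u \<in> closure (convex hull (x ` I))"
  shows "\<bar>inner u v - l\<bar> \<le> e"
proof -
  let ?S = "{y. inner y v \<le> l + e} \<inter> {y. inner y v \<ge> l - e}"
  have "convex ?S"
    by (intro convex_Int) (simp_all add: convex_halfspace_le convex_halfspace_ge inner_commute[of _ v])
  moreover have "closed ?S"
    by (intro closed_Int) (simp_all add: closed_halfspace_le closed_halfspace_ge inner_commute[of _ v])
  moreover have "x ` I \<subseteq> ?S" using assms(1) by (fastforce simp: abs_le_iff)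
  ultimately have "closure (convex hull (x ` I)) \<subseteq> ?S"
    by (intro closure_minimal hull_minimal)
  then show ?thesis using assms(2) by (auto simp: abs_le_iff)
qed

text \<open>A single construction yields the Riesz representative of the limit functional and Mazur's
  lemma: the weak limit is the point common to the closed convex hulls of all tails.\<close>

lemma weak_limit_in_convex_hull_tails:
  fixes x :: "nat \<Rightarrow> 'a::{real_inner, complete_space}"
  assumes bdd: "bounded (range x)" and lim: "\<And>v. (\<lambda>n. inner (x n) v) \<longlonglongrightarrow> l v"
  obtains u where "weakly_converges x u" "\<And>n. u \<in> closure (convex hull (x ` {n..}))"
proof -
  let ?C = "\<lambda>n. closure (convex hull (x ` {n..}))"
  have "(\<Inter>n. ?C n) \<noteq> {}"
  proof (rule nested_closed_convex_bounded_Inter_nonempty)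
    show "decseq ?C" unfolding decseq_def by (intro allI impI closure_mono hull_mono image_mono) auto
    show "bounded (?C 0)"
      using bdd by (intro bounded_closure bounded_convex_hull) (auto simp: atLeast_0)
  qed (auto intro: convex_closure convex_convex_hull)
  then obtain u where u: "\<And>n. u \<in> ?C n" by blast
  have "inner u v = l v" for v
  proof (rule ccontr)
    assume ne: "inner u v \<noteq> l v"
    \<comment> \<open>Closed hulls keep only a non-strict inequality, so half of the discrepancy
      serves as tolerance.\<close>
    let ?e = "\<bar>inner u v - l v\<bar> / 2"
    have "0 < ?e" using ne by simp
    from tendstoD[OF lim[of v] this] obtain n where n: "\<bar>inner (x m) v - l v\<bar> < ?e" if "m \<ge> n" for m
      by (auto simp: eventually_sequentially dist_real_def)
    have "\<bar>inner u v - l v\<bar> \<le> ?e"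
      by (rule inner_convex_hull_dist[OF _ u[of n]]) (use n in \<open>auto intro: less_imp_le\<close>)
    with \<open>0 < ?e\<close> show False by simp
  qed
  then have "weakly_converges x u" using lim by (simp add: weakly_converges_def)
  then show ?thesis using u by (rule that)
qed

section \<open>Weak limits, weak compactness and compact operators\<close>

lemma weakly_converges_unique:
  assumes "weakly_converges x u" "weakly_converges x v"
  shows "u = v"
proof -
  have "inner u w = inner v w" for w
    using assms LIMSEQ_unique unfolding weakly_converges_def by blast
  then have "inner (u - v) (u - v) = 0" by (simp add: inner_diff_left)
  then show ?thesis by simp
qed

lemma weakly_converges_subseq:
  assumes "weakly_converges x u" "strict_mono r"
  shows "weakly_converges (x \<circ> r) u"
  using assms LIMSEQ_subseq_LIMSEQ unfolding weakly_converges_def by (fastforce simp: comp_def)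

text \<open>The construction only yields some weak limit lying in all tail hulls; uniqueness
  identifies it with the given \<open>u\<close>.\<close>

lemma weak_limit_closure_convex_hull:
  fixes x :: "nat \<Rightarrow> 'a::{real_inner, complete_space}"
  assumes "bounded (range x)" "weakly_converges x u"
  shows "u \<in> closure (convex hull (x ` {n..}))"
proof -
  have "\<And>v. (\<lambda>n. inner (x n) v) \<longlonglongrightarrow> inner u v" using assms(2) by (simp add: weakly_converges_def)
  from weak_limit_in_convex_hull_tails[OF assms(1) this] obtain u' where
    u': "weakly_converges x u'" "\<And>n. u' \<in> closure (convex hull (x ` {n..}))" by metis
  then show ?thesis using weakly_converges_unique[OF assms(2) u'(1)] by simp
qed

text \<open>Applied to sublevel sets of \<psi> it acts as weak lower semicontinuity; applied to
  preimages of balls under \<open>B\<close> it locates \<open>B u\<close> for a weak limit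
  \<open>u\<close>.\<close>

lemma weak_limit_in_closed_convex:
  fixes x :: "nat \<Rightarrow> 'a::{real_inner, complete_space}"
  assumes "bounded (range x)" "weakly_converges x u" "closed S" "convex S"
    and "eventually (\<lambda>n. x n \<in> S) sequentially"
  shows "u \<in> S"
proof -
  obtain n where "\<And>m. m \<ge> n \<Longrightarrow> x m \<in> S" using assms(5) by (auto simp: eventually_sequentially)
  then have "closure (convex hull (x ` {n..})) \<subseteq> S"
    using assms(3,4) by (intro closure_minimal hull_minimal) auto
  then show ?thesis using weak_limit_closure_convex_hull[OF assms(1,2), of n] by blast
qed

text \<open>A diagonal subsequence converges against a countable dense set of test vectors;
  boundedness extends this to every \<open>v\<close>, and the limit functional is represented by a
  common point of the tail hulls.\<close>

lemma bounded_imp_weakly_convergent_subseq: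
  fixes x :: "nat \<Rightarrow> 'a::{real_inner, complete_space, second_countable_topology}"
  assumes bdd: "bounded (range x)"
  obtains r u where "strict_mono r" "weakly_converges (x \<circ> r) u"
proof -
  obtain R where R: "\<And>n. norm (x n) \<le> R" "0 < R" using bdd by (auto simp: bounded_pos)
  obtain D :: "'a set" where D: "countable D" "\<And>X. open X \<Longrightarrow> X \<noteq> {} \<Longrightarrow> \<exists>d\<in>D. d \<in> X"
    using countable_dense_setE by blast
  have "D \<noteq> {}" using D(2)[of UNIV] by auto
  define d where "d = from_nat_into D"
  have range_d: "range d = D" unfolding d_def using \<open>D \<noteq> {}\<close> D(1) by (rule range_from_nat_into)
  let ?P = "\<lambda>n s. convergent (\<lambda>k. inner (x (s k)) (d n))"
  interpret subseqs ?P
  proof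
    fix n and s :: "nat \<Rightarrow> nat" assume "strict_mono s"
    have "inner (x (s k)) (d n) \<in> cball 0 (R * norm (d n))" for k
      using order_trans[OF Cauchy_Schwarz_ineq2[of "x (s k)" "d n"] mult_right_mono[OF R(1)[of "s k"]]]
      by (simp add: dist_real_def)
    then obtain l r where "strict_mono r" "((\<lambda>k. inner (x (s k)) (d n)) \<circ> r) \<longlonglongrightarrow> l"
      using compact_imp_seq_compact[OF compact_cball[of "0::real"]] seq_compactE by metis
    then show "\<exists>r. strict_mono r \<and> convergent (\<lambda>k. inner (x ((s \<circ> r) k)) (d n))"
      by (auto simp: convergent_def comp_def)
  qed
  let ?y = "\<lambda>k. x (diagseq k)"
  have conv: "convergent (\<lambda>k. inner (?y k) (d n))" for n
  proof -
    \<comment> \<open>The diagonal sequence is guaranteed to refine the \<open>n\<close>-th choice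
      only from index \<open>Suc n\<close> on; the offset is removed afterwards.\<close>
    have "convergent (\<lambda>k. inner (x ((diagseq \<circ> (+) (Suc n)) k)) (d n))"
    proof (rule diagseq_holds)
      fix r s :: "nat \<Rightarrow> nat" and n
      assume "strict_mono r" "convergent (\<lambda>k. inner (x (s k)) (d n))"
      from convergent_subseq_convergent[OF this(2,1)]
      show "convergent (\<lambda>k. inner (x ((s \<circ> r) k)) (d n))" by (simp add: comp_def)
    qed
    then obtain L where "(\<lambda>k. inner (?y (k + Suc n)) (d n)) \<longlonglongrightarrow> L"
      by (auto simp: convergent_def add.commute)
    then have "(\<lambda>k. inner (?y k) (d n)) \<longlonglongrightarrow> L" by (rule LIMSEQ_offset)
    then show ?thesis by (auto simp: convergent_def)
  qed
  have conv_all: "convergent (\<lambda>k. inner (?y k) v)" for v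
  proof -
    have "Cauchy (\<lambda>k. inner (?y k) v)"
    proof (rule CauchyI)
      fix e :: real assume "0 < e"
      \<comment> \<open>After Cauchy-Schwarz this radius costs \<open>e / 3\<close> for each of the
        two sequence members; the last third is the Cauchy estimate at \<open>d n\<close>.\<close>
      then have "open (ball v (e / (3 * R)))" "v \<in> ball v (e / (3 * R))" using R(2) by auto
      then obtain n where n: "norm (v - d n) < e / (3 * R)"
        using D(2)[of "ball v (e / (3 * R))"] range_d by (auto simp: dist_norm)
      have close: "\<bar>inner (?y k) (v - d n)\<bar> < e / 3" for k
      proof -
        have "\<bar>inner (?y k) (v - d n)\<bar> \<le> norm (?y k) * norm (v - d n)" by (rule Cauchy_Schwarz_ineq2)
        also have "\<dots> \<le> R * norm (v - d n)" using R(1) by (intro mult_right_mono) auto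
        also have "\<dots> < R * (e / (3 * R))" using n R(2) by (intro mult_strict_left_mono)
        finally show ?thesis using R(2) by simp
      qed
      have "0 < e / 3" using \<open>0 < e\<close> by simp
      then obtain K where K: "\<And>j k. j \<ge> K \<Longrightarrow> k \<ge> K \<Longrightarrow> norm (inner (?y j) (d n) - inner (?y k) (d n)) < e / 3"
        using CauchyD[OF convergent_Cauchy[OF conv[of n]]] by metis
      have "norm (inner (?y j) v - inner (?y k) v) < e" if "j \<ge> K" "k \<ge> K" for j k
        using K[OF that] close[of j] close[of k] by (simp add: inner_diff_right) argo
      then show "\<exists>M. \<forall>m\<ge>M. \<forall>n\<ge>M. norm (inner (?y m) v - inner (?y n) v) < e" by blast
    qed
    then show ?thesis by (simp add: Cauchy_convergent_iff)
  qed
  then have lims: "\<And>v. (\<lambda>k. inner (?y k) v) \<longlonglongrightarrow> lim (\<lambda>k. inner (?y k) v)"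
    using convergent_LIMSEQ_iff by blast
  have "bounded (range ?y)" using bdd by (rule bounded_subset) auto
  then obtain u where "weakly_converges ?y u"
    by (rule weak_limit_in_convex_hull_tails[OF _ lims])
  then show ?thesis using that[OF subseq_diagseq, of u] by (simp add: comp_def)
qed

text \<open>Mazur's lemma replaces Hahn--Banach: \<open>B u\<close> lies in the closed convex hull of every tail of
  \<open>B x\<^sub>n\<close>, hence in every closed ball around the norm limit of a subsequence.\<close>

lemma compact_operator_weak_to_strong:
  fixes B :: "'a::{real_inner, complete_space} \<Rightarrow> 'b::real_normed_vector"
  assumes B: "compact_operator B" and bdd: "bounded (range x)" and weak: "weakly_converges x u"
  obtains r where "strict_mono r" "(\<lambda>n. B (x (r n))) \<longlonglongrightarrow> B u"
proof -
  have lin: "bounded_linear B" and cpt: "compact (closure (B ` cball 0 1))"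
    using B by (auto simp: compact_operator_def)
  obtain R where R: "\<And>n. norm (x n) \<le> R" "0 < R" using bdd by (auto simp: bounded_pos)
  have "B (x n /\<^sub>R R) \<in> closure (B ` cball 0 1)" for n
    using R by (intro closure_subset[THEN subsetD] imageI) (simp add: field_simps)
  then obtain y r where r: "strict_mono r" and "((\<lambda>n. B (x n /\<^sub>R R)) \<circ> r) \<longlonglongrightarrow> y"
    using compact_imp_seq_compact[OF cpt] seq_compactE by metis
  then have "(\<lambda>n. R *\<^sub>R B (x (r n) /\<^sub>R R)) \<longlonglongrightarrow> R *\<^sub>R y"
    by (intro tendsto_intros) (simp add: comp_def)
  then have y: "(\<lambda>n. B (x (r n))) \<longlonglongrightarrow> R *\<^sub>R y"
    using R(2) by (simp add: linear_simps(5)[OF lin])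
  have "dist (R *\<^sub>R y) (B u) \<le> e" if e: "0 < e" for e
  proof -
    obtain n where n: "\<And>m. m \<ge> n \<Longrightarrow> dist (B (x (r m))) (R *\<^sub>R y) < e"
      using tendstoD[OF y e] by (auto simp: eventually_sequentially)
    let ?S = "B -` cball (R *\<^sub>R y) e"
    have "closed ?S"
      using lin by (intro closed_vimage closed_cball linear_continuous_on)
    moreover have "convex ?S"
      using lin by (intro convex_linear_vimage convex_cball) (rule bounded_linear.linear)
    moreover have "eventually (\<lambda>m. (x \<circ> r) m \<in> ?S) sequentially"
      using n by (auto simp: eventually_sequentially dist_commute intro!: exI[of _ n] less_imp_le)
    moreover have "bounded (range (x \<circ> r))" using bdd by (rule bounded_subset) auto
    ultimately have "u \<in> ?S"
      using weakly_converges_subseq[OF weak r] by (intro weak_limit_in_closed_convex[of "x \<circ> r" u ?S])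
    then show ?thesis by simp
  qed
  then have "R *\<^sub>R y = B u" by (meson dense_ge dist_le_zero_iff)
  with y r show ?thesis using that by simp
qed

text \<open>Compactness of \<open>B\<close> alone gives relative compactness. That limits stay in
  the image comes from \<open>S\<close> being weakly sequentially closed, which convexity
  supplies.\<close>

lemma compact_operator_image_compact:
  fixes B :: "'a::{real_inner, complete_space, second_countable_topology} \<Rightarrow> 'b::real_normed_vector"
  assumes B: "compact_operator B" and S: "closed S" "convex S" "bounded S"
  shows "compact (B ` S)"
  unfolding compact_eq_seq_compact_metric
proof (rule seq_compactI)
  fix y :: "nat \<Rightarrow> 'b" assume "\<forall>n. y n \<in> B ` S"
  then have "\<forall>n. \<exists>x. x \<in> S \<and> y n = B x" by auto
  then obtain x where x: "\<And>n. x n \<in> S" "\<And>n. y n = B (x n)" by metis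
  have bx: "bounded (range (x \<circ> r))" for r :: "nat \<Rightarrow> nat"
    using S(3) by (rule bounded_subset) (use x in auto)
  obtain r u where r: "strict_mono r" and u: "weakly_converges (x \<circ> r) u"
    using bounded_imp_weakly_convergent_subseq[OF bx[of id]] by auto
  have "u \<in> S" using weak_limit_in_closed_convex[OF bx u S(1,2)] x by simp
  moreover obtain r' where "strict_mono r'" "(\<lambda>n. B ((x \<circ> r) (r' n))) \<longlonglongrightarrow> B u"
    by (rule compact_operator_weak_to_strong[OF B bx u])
  ultimately show "\<exists>l\<in>B ` S. \<exists>r. strict_mono r \<and> (y \<circ> r) \<longlonglongrightarrow> l"
    using r x by (intro bexI[of _ "B u"] exI[of _ "r \<circ> r'"]) (auto simp: comp_def strict_mono_def)
qed

section \<open>Gap functionals\<close>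

lemma closed_sublevel:
  assumes "closed_fun \<psi>"
  shows "closed {u. \<psi> u \<le> ereal t}"
proof -
  have "closed ((\<lambda>u. (u, t)) -` {(u, t::real). \<psi> u \<le> ereal t})"
    using assms unfolding closed_fun_def by (intro closed_vimage continuous_intros) auto
  then show ?thesis by (simp add: vimage_def)
qed

lemma convex_sublevel:
  assumes "convex_fun \<psi>"
  shows "convex {u. \<psi> u \<le> ereal t}"
proof (rule convexI)
  fix a b and p q :: real
  assume ab: "a \<in> {u. \<psi> u \<le> ereal t}" "b \<in> {u. \<psi> u \<le> ereal t}" and pq: "0 \<le> p" "0 \<le> q" "p + q = 1"
  have "p *\<^sub>R (a, t) + q *\<^sub>R (b, t) \<in> {(u, t::real). \<psi> u \<le> ereal t}"
    using assms ab pq unfolding convex_fun_def by (intro convexD) auto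
  moreover have "p * t + q * t = t" using pq(3) by (metis distrib_right mult_1)
  ultimately show "p *\<^sub>R a + q *\<^sub>R b \<in> {u. \<psi> u \<le> ereal t}" by simp
qed

lemma sublevel_subset_dom: "{u. \<psi> u \<le> ereal t} \<subseteq> dom_fun \<psi>"
  by (auto simp: dom_fun_def)

lemma gap_upper:
  "v \<in> dom_fun \<psi> \<Longrightarrow> ereal (inner d (u - v) + real_of_ereal (\<psi> u) - real_of_ereal (\<psi> v)) \<le> gap \<psi> d u"
  unfolding gap_def by (rule SUP_upper)

text \<open>The competitor \<open>v = u\<close> contributes zero.\<close>

lemma gap_nonneg: "u \<in> dom_fun \<psi> \<Longrightarrow> 0 \<le> gap \<psi> d u"
  using gap_upper[of u \<psi> d u] by (simp add: zero_ereal_def)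

text \<open>One-sided control of the pairings is enough, since the opposite bound on the gap is
  \<open>gap_nonneg\<close>.\<close>

lemma gap_perturb:
  assumes "gap \<psi> d u \<le> ereal \<epsilon>"
    and "\<And>v. v \<in> dom_fun \<psi> \<Longrightarrow> inner d' (u - v) \<le> inner d (u - v) + \<eta>"
  shows "gap \<psi> d' u \<le> ereal (\<epsilon> + \<eta>)"
  unfolding gap_def
proof (rule SUP_least)
  fix v assume v: "v \<in> dom_fun \<psi>"
  have "ereal (inner d (u - v) + real_of_ereal (\<psi> u) - real_of_ereal (\<psi> v)) \<le> ereal \<epsilon>"
    using gap_upper[OF v] assms(1) by (rule order_trans)
  then show "ereal (inner d' (u - v) + real_of_ereal (\<psi> u) - real_of_ereal (\<psi> v)) \<le> ereal (\<epsilon> + \<eta>)"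
    using assms(2)[OF v] by simp
qed

text \<open>The pathwise core: one outcome is fixed, and its sampled gradients enter through a norm
  bound and their limit behaviour. The hypotheses on \<open>x\<close> start at index 1, the first
  genuine sample size.\<close>

lemma gap_consistency:
  fixes B :: "'u::{real_inner, complete_space, second_countable_topology} \<Rightarrow> 'w::real_normed_vector"
    and Bstar :: "('w \<Rightarrow>\<^sub>L real) \<Rightarrow> 'u" and \<psi> :: "'u \<Rightarrow> ereal"
    and G :: "nat \<Rightarrow> 'w \<Rightarrow> ('w \<Rightarrow>\<^sub>L real)" and Ginf :: "'w \<Rightarrow> ('w \<Rightarrow>\<^sub>L real)"
  defines "K \<equiv> \<lambda>c. (B ` {u. \<psi> u \<le> ereal (real (c::nat))}) \<times> closure (B ` cball 0 1)"
  assumes B_compact: "compact_operator B"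
    and Bstar_adjoint: "\<And>\<phi> u. inner (Bstar \<phi>) u = blinfun_apply \<phi> (B u)"
    and psi_nonneg: "\<And>u. \<psi> u \<ge> 0"
    and psi_proper: "proper_fun \<psi>"
    and psi_closed: "closed_fun \<psi>"
    and psi_convex: "convex_fun \<psi>"
    and dom_bounded: "bounded (dom_fun \<psi>)"
    and G_bound: "\<And>N w. w \<in> B ` dom_fun \<psi> \<Longrightarrow> norm (G N w) \<le> b"
    and G_lim: "\<And>c. uniform_limit (K c) (\<lambda>N (w, z). G N w z) (\<lambda>(w, z). Ginf w z) sequentially"
    and Ginf_cont: "\<And>c. continuous_on (K c) (\<lambda>(w, z). Ginf w z)"
    and \<epsilon>_lim: "\<epsilon> \<longlonglongrightarrow> 0"
    and x_dom: "\<And>N. N \<ge> 1 \<Longrightarrow> x N \<in> dom_fun \<psi>"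
    and x_gap: "\<And>N. N \<ge> 1 \<Longrightarrow> gap \<psi> (Bstar (G N (B (x N)))) (x N) \<le> ereal (\<epsilon> N)"
  shows gap_consistency_tendsto: "(\<lambda>N. gap \<psi> (Bstar (Ginf (B (x N)))) (x N)) \<longlonglongrightarrow> 0"
    and gap_consistency_exists: "\<exists>u. weak_accumulation_point x u"
    and gap_consistency_zero: "weak_accumulation_point x u \<Longrightarrow>
          u \<in> dom_fun \<psi> \<and> gap \<psi> (Bstar (Ginf (B u))) u = 0"
proof -
  let ?D = "dom_fun \<psi>" and ?p = "\<lambda>u. real_of_ereal (\<psi> u)" and ?Z = "closure (B ` cball 0 1)"
  have lin: "bounded_linear B" using B_compact by (simp add: compact_operator_def)
  interpret B: bounded_linear B by (rule lin)
  have le_real: "\<psi> u \<le> ereal t \<longleftrightarrow> ?p u \<le> t" if "u \<in> ?D" for u t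
    using that psi_nonneg[of u] by (cases "\<psi> u") (auto simp: dom_fun_def)
  obtain R where R: "\<And>u. u \<in> ?D \<Longrightarrow> norm u \<le> R" "0 < R"
    using dom_bounded by (auto simp: bounded_pos)
  \<comment> \<open>Differences of points of the domain have norm at most \<open>2 * R\<close>;
    dividing by this reaches the unit ball, and \<open>inner_z\<close> restores the factor.\<close>
  define z where "z u v = B ((u - v) /\<^sub>R (2 * R))" for u v
  have z_Z: "z u v \<in> ?Z" if "u \<in> ?D" "v \<in> ?D" for u v
  proof -
    have "norm (u - v) \<le> 2 * R" using norm_triangle_ineq4[of u v] R(1)[OF that(1)] R(1)[OF that(2)] by linarith
    then have "norm ((u - v) /\<^sub>R (2 * R)) \<le> 1" using R(2) by (simp add: inverse_eq_divide divide_le_eq)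
    then show ?thesis unfolding z_def by (intro closure_subset[THEN subsetD] imageI) simp
  qed
  have inner_z: "inner (Bstar \<phi>) (u - v) = 2 * R * blinfun_apply \<phi> (z u v)" for \<phi> u v
    using R(2) unfolding Bstar_adjoint z_def by (simp add: B.scaleR blinfun.scaleR_right)
  obtain v0 where v0: "v0 \<in> ?D" using psi_proper by (auto simp: proper_fun_def)
  obtain \<epsilon>0 where \<epsilon>0: "\<And>N. \<epsilon> N \<le> \<epsilon>0"
    using convergent_imp_bounded[OF \<epsilon>_lim] by (auto simp: bounded_iff) (meson abs_le_D1)
  obtain bZ where bZ: "\<And>y. y \<in> ?Z \<Longrightarrow> norm y \<le> bZ" "0 < bZ"
    using compact_imp_bounded[of ?Z] B_compact by (auto simp: compact_operator_def bounded_pos)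
  \<comment> \<open>Testing the gap at the fixed \<open>v0\<close> bounds \<open>?p (x N)\<close> by
    \<open>\<epsilon> N\<close>, \<open>?p v0\<close> and a pairing that is at most
    \<open>2 * R * (b * bZ)\<close> in absolute value.\<close>
  define c where "c = nat \<lceil>\<epsilon>0 + 2 * R * (b * bZ) + ?p v0\<rceil>"
  have x_c: "\<psi> (x N) \<le> ereal (real c)" if N: "N \<ge> 1" for N
  proof -
    let ?\<phi> = "G N (B (x N))"
    have "\<bar>blinfun_apply ?\<phi> (z (x N) v0)\<bar> \<le> norm ?\<phi> * norm (z (x N) v0)"
      using norm_blinfun[of ?\<phi> "z (x N) v0"] by simp
    also have "\<dots> \<le> b * bZ"
      using G_bound[of "B (x N)" N] bZ(1)[OF z_Z[OF x_dom[OF N] v0]] x_dom[OF N]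
      by (intro mult_mono) (auto intro: order_trans[OF norm_ge_zero])
    finally have "2 * R * (- blinfun_apply ?\<phi> (z (x N) v0)) \<le> 2 * R * (b * bZ)"
      using R(2) by (intro mult_left_mono) auto
    moreover have "ereal (inner (Bstar ?\<phi>) (x N - v0) + ?p (x N) - ?p v0) \<le> ereal (\<epsilon> N)"
      using gap_upper[OF v0] x_gap[OF N] by (rule order_trans)
    ultimately have "?p (x N) \<le> \<epsilon>0 + 2 * R * (b * bZ) + ?p v0"
      using \<epsilon>0[of N] unfolding inner_z by simp
    then have "?p (x N) \<le> real c" unfolding c_def by linarith
    then show ?thesis using le_real[OF x_dom[OF N]] by simp
  qed
  have x_K: "(B (x N), z (x N) v) \<in> K c" if "N \<ge> 1" "v \<in> ?D" for N v
    using x_c[OF that(1)] z_Z[OF x_dom[OF that(1)] that(2)] unfolding K_def by auto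

  show lim: "(\<lambda>N. gap \<psi> (Bstar (Ginf (B (x N)))) (x N)) \<longlonglongrightarrow> 0"
  proof (rule order_tendstoI)
    fix a :: ereal assume "a < 0"
    show "eventually (\<lambda>N. a < gap \<psi> (Bstar (Ginf (B (x N)))) (x N)) sequentially"
      using eventually_ge_at_top[of 1]
      by eventually_elim (rule less_le_trans[OF \<open>a < 0\<close> gap_nonneg[OF x_dom]])
  next
    fix a :: ereal assume "0 < a"
    then obtain e where e: "0 < ereal e" "ereal e < a" using ereal_dense2 by blast
    \<comment> \<open>A deviation of \<open>e / (4 * R)\<close> in the pairings becomes
      \<open>e / 2\<close> after the factor \<open>2 * R\<close>; the other half is left for
      \<open>\<epsilon> N\<close>.\<close>
    then have "0 < e / 2" "0 < e / (4 * R)" using R(2) by auto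
    have "eventually (\<lambda>N. \<epsilon> N < e / 2) sequentially"
      using \<epsilon>_lim \<open>0 < e / 2\<close> by (rule order_tendstoD(2))
    moreover have "eventually (\<lambda>N. \<forall>k\<in>K c. dist (case k of (w, z) \<Rightarrow> G N w z) (case k of (w, z) \<Rightarrow> Ginf w z) < e / (4 * R)) sequentially"
      using G_lim[of c] \<open>0 < e / (4 * R)\<close> unfolding uniform_limit_iff by blast
    ultimately show "eventually (\<lambda>N. gap \<psi> (Bstar (Ginf (B (x N)))) (x N) < a) sequentially"
      using eventually_ge_at_top[of 1]
    proof eventually_elim
      case (elim N)
      have "gap \<psi> (Bstar (Ginf (B (x N)))) (x N) \<le> ereal (\<epsilon> N + e / 2)"
        using x_gap[OF elim(3)]
      proof (rule gap_perturb)
        fix v assume "v \<in> ?D"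
        from x_K[OF elim(3) this] elim(2)
        have "dist (G N (B (x N)) (z (x N) v)) (Ginf (B (x N)) (z (x N) v)) < e / (4 * R)" by force
        then have "Ginf (B (x N)) (z (x N) v) \<le> G N (B (x N)) (z (x N) v) + e / (4 * R)"
          unfolding dist_real_def by linarith
        then have "2 * R * Ginf (B (x N)) (z (x N) v) \<le> 2 * R * (G N (B (x N)) (z (x N) v) + e / (4 * R))"
          using R(2) by (intro mult_left_mono) auto
        also have "\<dots> = 2 * R * G N (B (x N)) (z (x N) v) + e / 2"
          using R(2) by (simp add: field_simps)
        finally show "inner (Bstar (Ginf (B (x N)))) (x N - v) \<le> inner (Bstar (G N (B (x N)))) (x N - v) + e / 2"
          unfolding inner_z .
      qed
      also have "\<dots> \<le> ereal e" using elim(1) by simp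
      finally show ?case using e(2) by (rule le_less_trans)
    qed
  qed

  have bounded_x: "bounded (range (\<lambda>n. x (s n)))" if "\<And>n. s n \<ge> 1" for s :: "nat \<Rightarrow> nat"
    using dom_bounded by (rule bounded_subset) (use x_dom that in auto)
  show "\<exists>u. weak_accumulation_point x u"
  proof -
    obtain r u where "strict_mono r" "weakly_converges ((\<lambda>n. x (Suc n)) \<circ> r) u"
      using bounded_imp_weakly_convergent_subseq[OF bounded_x[of Suc]] by auto
    then have "strict_mono (\<lambda>n. Suc (r n))" "weakly_converges (x \<circ> (\<lambda>n. Suc (r n))) u"
      by (auto simp: strict_mono_def comp_def)
    then show ?thesis unfolding weak_accumulation_point_def by blast
  qed

  show "u \<in> ?D \<and> gap \<psi> (Bstar (Ginf (B u))) u = 0" if acc: "weak_accumulation_point x u"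
  proof -
    obtain r where r: "strict_mono r" "weakly_converges (x \<circ> r) u"
      using acc by (auto simp: weak_accumulation_point_def)
    \<comment> \<open>The shift keeps every index at least 1, since \<open>x 0\<close> is
      unconstrained.\<close>
    define s where "s n = r (Suc n)" for n
    have s: "strict_mono s" "s n \<ge> 1" for n
      using r(1) strict_mono_imp_increasing[OF r(1), of "Suc n"] by (auto simp: s_def strict_mono_def)
    have s_weak: "weakly_converges (\<lambda>n. x (s n)) u"
      using weakly_converges_subseq[OF r(2), of Suc] by (simp add: s_def comp_def strict_mono_def)
    have u_c: "u \<in> {u. \<psi> u \<le> ereal (real c)}"
      using s(2) x_c by (intro weak_limit_in_closed_convex[OF bounded_x[OF s(2)] s_weak]
        closed_sublevel convex_sublevel psi_closed psi_convex) auto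
    then have u_D: "u \<in> ?D" by (rule subsetD[OF sublevel_subset_dom])
    \<comment> \<open>A further subsequence is harmless: the weak limit persists, and the gaps tend
      to zero along the full sequence.\<close>
    obtain r' where r': "strict_mono r'" "(\<lambda>n. B (x (s (r' n)))) \<longlonglongrightarrow> B u"
      by (rule compact_operator_weak_to_strong[OF B_compact bounded_x[OF s(2)] s_weak])
    define t where "t n = s (r' n)" for n
    have t: "strict_mono t" "t n \<ge> 1" for n
      using s r'(1) by (auto simp: t_def strict_mono_def)
    have t_weak: "weakly_converges (\<lambda>n. x (t n)) u"
      using weakly_converges_subseq[OF s_weak r'(1)] by (simp add: t_def comp_def)
    have t_lim: "(\<lambda>n. B (x (t n))) \<longlonglongrightarrow> B u" using r'(2) by (simp add: t_def)
    have gap_t: "(\<lambda>n. gap \<psi> (Bstar (Ginf (B (x (t n))))) (x (t n))) \<longlonglongrightarrow> 0"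
      using LIMSEQ_subseq_LIMSEQ[OF lim t(1)] by (simp add: comp_def)
    have "gap \<psi> (Bstar (Ginf (B u))) u \<le> 0"
      unfolding gap_def
    proof (rule SUP_least)
      fix v assume v: "v \<in> ?D"
      let ?a = "\<lambda>y. inner (Bstar (Ginf (B y))) (y - v)"
      have z_eq: "z y v = (B y - B v) /\<^sub>R (2 * R)" for y
        unfolding z_def by (simp add: B.scaleR B.diff)
      have "(\<lambda>n. (B (x (t n)), z (x (t n)) v)) \<longlonglongrightarrow> (B u, z u v)"
        unfolding z_eq by (intro tendsto_intros t_lim)
      moreover have "(B u, z u v) \<in> K c" using u_c z_Z[OF u_D v] by (auto simp: K_def)
      ultimately have "(\<lambda>n. case (B (x (t n)), z (x (t n)) v) of (w, z) \<Rightarrow> Ginf w z)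
          \<longlonglongrightarrow> (case (B u, z u v) of (w, z) \<Rightarrow> Ginf w z)"
        by (rule continuous_on_tendsto_compose[OF Ginf_cont]) (use x_K[OF t(2) v] in auto)
      then have a_lim: "(\<lambda>n. ?a (x (t n))) \<longlonglongrightarrow> ?a u"
        unfolding inner_z by (intro tendsto_mult_left) simp
      \<comment> \<open>Lower semicontinuity in sublevel form: the iterates eventually satisfy
        \<open>\<psi> y \<le> ?p v - ?a u + e\<close>, a closed convex condition that
        \<open>u\<close> inherits. Half of \<open>e\<close> pays for the gap, half for the
        pairing.\<close>
      have "?p u \<le> ?p v - ?a u + e" if "0 < e" for e
      proof -
        have "eventually (\<lambda>n. gap \<psi> (Bstar (Ginf (B (x (t n))))) (x (t n)) < ereal (e / 2)) sequentially"
          using gap_t that by (intro order_tendstoD(2)) auto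
        moreover have "eventually (\<lambda>n. ?a u - e / 2 < ?a (x (t n))) sequentially"
          using a_lim that by (intro order_tendstoD(1)) auto
        ultimately have "eventually (\<lambda>n. x (t n) \<in> {y. \<psi> y \<le> ereal (?p v - ?a u + e)}) sequentially"
        proof eventually_elim
          case (elim n)
          have "ereal (?a (x (t n)) + ?p (x (t n)) - ?p v) < ereal (e / 2)"
            using gap_upper[OF v] elim(1) by (rule le_less_trans)
          then have "?p (x (t n)) \<le> ?p v - ?a u + e" using elim(2) by simp
          then show ?case unfolding mem_Collect_eq le_real[OF x_dom[OF t(2)]] .
        qed
        then have "u \<in> {y. \<psi> y \<le> ereal (?p v - ?a u + e)}"
          by (rule weak_limit_in_closed_convex[OF bounded_x[OF t(2)] t_weak
              closed_sublevel[OF psi_closed] convex_sublevel[OF psi_convex]])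
        then show ?thesis unfolding mem_Collect_eq le_real[OF u_D] .
      qed
      then have "?p u \<le> ?p v - ?a u" by (rule field_le_epsilon)
      then show "ereal (?a u + ?p u - ?p v) \<le> 0" by simp
    qed
    then show ?thesis using u_D gap_nonneg[OF u_D] by (auto intro: antisym)
  qed
qed

text \<open>\<open>Blinfun\<close> is meaningful only on bounded linear maps, so the work lies in
  showing that the pointwise integral is one; the integral of \<zeta> bounds its norm.\<close>

lemma dual_expectation_apply:
  fixes G :: "'a \<Rightarrow> ('w::real_normed_vector \<Rightarrow>\<^sub>L real)"
  assumes meas: "G \<in> borel_measurable M" and bound: "\<And>\<omega>. norm (G \<omega>) \<le> \<zeta> \<omega>" and int: "integrable M \<zeta>"
  shows "blinfun_apply (dual_expectation M G) z = (\<integral>\<omega>. blinfun_apply (G \<omega>) z \<partial>M)"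
proof -
  have m: "(\<lambda>\<omega>. blinfun_apply (G \<omega>) y) \<in> borel_measurable M" for y
    using borel_measurable_continuous_onI[OF linear_continuous_on[OF blinfun.bounded_linear_left]]
    by (rule measurable_compose[OF meas])
  have le: "\<bar>blinfun_apply (G \<omega>) y\<bar> \<le> \<zeta> \<omega> * norm y" for \<omega> y
    using norm_blinfun[of "G \<omega>" y] mult_right_mono[OF bound[of \<omega>] norm_ge_zero[of y]] by simp
  have i: "integrable M (\<lambda>\<omega>. blinfun_apply (G \<omega>) y)" for y
  proof (rule Bochner_Integration.integrable_bound[OF _ m])
    show "integrable M (\<lambda>\<omega>. \<zeta> \<omega> * norm y)" using int by simp
    show "AE \<omega> in M. norm (blinfun_apply (G \<omega>) y) \<le> norm (\<zeta> \<omega> * norm y)"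
    proof (rule AE_I2)
      fix \<omega> show "norm (blinfun_apply (G \<omega>) y) \<le> norm (\<zeta> \<omega> * norm y)" using le[of \<omega> y] by simp
    qed
  qed
  have "bounded_linear (\<lambda>y. \<integral>\<omega>. blinfun_apply (G \<omega>) y \<partial>M)"
  proof (rule bounded_linear_intro[where K="\<integral>\<omega>. \<zeta> \<omega> \<partial>M"])
    fix y
    have "\<bar>\<integral>\<omega>. blinfun_apply (G \<omega>) y \<partial>M\<bar> \<le> (\<integral>\<omega>. \<bar>blinfun_apply (G \<omega>) y\<bar> \<partial>M)"
      by (rule integral_abs_bound)
    also have "\<dots> \<le> (\<integral>\<omega>. \<zeta> \<omega> * norm y \<partial>M)" using i int le by (intro integral_mono) auto
    finally show "norm (\<integral>\<omega>. blinfun_apply (G \<omega>) y \<partial>M) \<le> norm y * (\<integral>\<omega>. \<zeta> \<omega> \<partial>M)"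
      by (simp add: mult.commute)
  qed (use i in \<open>simp_all add: blinfun.add_right blinfun.scaleR_right\<close>)
  then show ?thesis unfolding dual_expectation_def by (simp add: bounded_linear_Blinfun_apply)
qed

theorem theorem3p6:
  fixes B :: "'u::{real_inner, complete_space, second_countable_topology} \<Rightarrow> 'w::{banach, second_countable_topology}"
    and Bstar :: "('w \<Rightarrow>\<^sub>L real) \<Rightarrow> 'u"
    and \<psi> :: "'u \<Rightarrow> ereal"
    and U0 :: "'u set"
    and M :: "'a measure"
    and \<xi> :: "'a \<Rightarrow> 'x::polish_space"
    and \<xi>s :: "nat \<Rightarrow> 'a \<Rightarrow> 'x"
    and f :: "'w \<Rightarrow> 'x \<Rightarrow> real"
    and \<zeta>f :: "'x \<Rightarrow> real"
    and gradg :: "'x \<Rightarrow> 'u \<Rightarrow> 'u"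
    and Dwf :: "'w \<Rightarrow> 'x \<Rightarrow> ('w \<Rightarrow>\<^sub>L real)"
    and \<zeta>Df :: "'x \<Rightarrow> real"
    and DF :: "'w \<Rightarrow> ('w \<Rightarrow>\<^sub>L real)"
    and DFhat :: "nat \<Rightarrow> 'a \<Rightarrow> 'w \<Rightarrow> ('w \<Rightarrow>\<^sub>L real)"
    and \<epsilon> :: "nat \<Rightarrow> real"
    and ubar :: "nat \<Rightarrow> 'a \<Rightarrow> 'u"
  assumes B_compact: "compact_operator B"
    and Bstar_adjoint: "\<And>\<phi> u. inner (Bstar \<phi>) u = blinfun_apply \<phi> (B u)"
    and psi_nonneg: "\<And>u. \<psi> u \<ge> 0"
    and psi_proper: "proper_fun \<psi>"
    and psi_closed: "closed_fun \<psi>"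
    and psi_convex: "convex_fun \<psi>"
    and dom_bounded: "bounded (dom_fun \<psi>)"
    and U0_open: "open U0" and U0_convex: "convex U0" and U0_bounded: "bounded U0"
    and dom_sub: "dom_fun \<psi> \<subseteq> U0"
    and M_prob: "prob_space M"
    and M_complete: "complete_measure M"
    and \<xi>_meas: "\<xi> \<in> M \<rightarrow>\<^sub>M borel"
    and \<xi>s_meas: "\<And>i. i \<ge> 1 \<Longrightarrow> \<xi>s i \<in> M \<rightarrow>\<^sub>M borel"
    and \<xi>s_distr: "\<And>i. i \<ge> 1 \<Longrightarrow> distr M borel (\<xi>s i) = distr M borel \<xi>"
    and \<xi>s_indep: "prob_space.indep_vars M (\<lambda>_. borel) \<xi>s {1..}"
    and f_cont: "\<And>x. continuous_on (B ` dom_fun \<psi>) (\<lambda>w. f w x)"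
    and f_meas: "\<And>w. w \<in> B ` U0 \<Longrightarrow> f w \<in> borel_measurable borel"
    and f_bound: "\<And>u x. u \<in> U0 \<Longrightarrow> \<bar>f (B u) x\<bar> \<le> \<zeta>f x"
    and \<zeta>f_int: "integrable (distr M borel \<xi>) \<zeta>f"
    and g_deriv: "\<And>x u. u \<in> U0 \<Longrightarrow>
        ((\<lambda>v. f (B v) x) has_derivative (\<lambda>h. inner (gradg x u) h)) (at u)"
    and g_C1: "\<And>x. continuous_on U0 (gradg x)"
    and Dwf_cont: "\<And>x. continuous_on (B ` dom_fun \<psi>) (\<lambda>w. Dwf w x)"
    and Dwf_meas: "\<And>w. w \<in> B ` dom_fun \<psi> \<Longrightarrow> Dwf w \<in> borel_measurable borel"
    and grad_eq: "\<And>x u. u \<in> dom_fun \<psi> \<Longrightarrow> gradg x u = Bstar (Dwf (B u) x)"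
    and \<zeta>Df_nonneg: "\<And>x. \<zeta>Df x \<ge> 0"
    and \<zeta>Df_int: "integrable (distr M borel \<xi>) \<zeta>Df"
    and grad_bound: "\<And>x u. u \<in> U0 \<Longrightarrow> norm (gradg x u) \<le> \<zeta>Df x"
    and Dwf_bound: "\<And>x u. u \<in> dom_fun \<psi> \<Longrightarrow> norm (Dwf (B u) x) \<le> \<zeta>Df x"
    and DF_def: "\<And>w. w \<in> B ` dom_fun \<psi> \<Longrightarrow> DF w = dual_expectation M (\<lambda>\<omega>. Dwf w (\<xi> \<omega>))"
    and DFhat_def: "\<And>N \<omega> w. w \<in> B ` dom_fun \<psi> \<Longrightarrow>
        DFhat N \<omega> w = (1 / real N) *\<^sub>R (\<Sum>i\<in>{1..N}. Dwf w (\<xi>s i \<omega>))"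
    and \<epsilon>_nonneg: "\<And>N. \<epsilon> N \<ge> 0"
    and \<epsilon>_lim: "\<epsilon> \<longlonglongrightarrow> 0"
    and ubar_meas: "\<And>N. N \<ge> 1 \<Longrightarrow> ubar N \<in> borel_measurable M"
    and ubar_dom: "\<And>N \<omega>. N \<ge> 1 \<Longrightarrow> \<omega> \<in> space M \<Longrightarrow> ubar N \<omega> \<in> dom_fun \<psi>"
    and ubar_gap: "\<And>N. N \<ge> 1 \<Longrightarrow>
        (AE \<omega> in M. gap \<psi> (Bstar (DFhat N \<omega> (B (ubar N \<omega>)))) (ubar N \<omega>) \<le> ereal (\<epsilon> N))"
  shows "(AE \<omega> in M. (\<lambda>N. gap \<psi> (Bstar (DF (B (ubar N \<omega>)))) (ubar N \<omega>)) \<longlonglongrightarrow> 0)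
    \<and> (AE \<omega> in M. (\<exists>u. weak_accumulation_point (\<lambda>N. ubar N \<omega>) u)
         \<and> (\<forall>u. weak_accumulation_point (\<lambda>N. ubar N \<omega>) u \<longrightarrow>
               u \<in> dom_fun \<psi> \<and> gap \<psi> (Bstar (DF (B u))) u = 0))"
proof -
  interpret prob_space M by (rule M_prob)
  let ?D = "dom_fun \<psi>" and ?Q = "distr M borel \<xi>" and ?Z = "closure (B ` cball 0 1)"
  let ?K = "\<lambda>c::nat. (B ` {u. \<psi> u \<le> ereal (real c)}) \<times> ?Z"
  let ?A = "\<lambda>h N \<omega>. (1 / real N) * (\<Sum>i\<in>{1..N}. h (\<xi>s i \<omega>))"
  have K_D: "w \<in> B ` ?D" if "(w, z) \<in> ?K c" for w z c
    using that sublevel_subset_dom[of \<psi> "real c"] by auto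
  have Z_compact: "compact ?Z" using B_compact by (simp add: compact_operator_def)
  then obtain bZ where bZ: "\<And>y. y \<in> ?Z \<Longrightarrow> norm y \<le> bZ" "0 < bZ"
    using compact_imp_bounded[of ?Z] by (auto simp: bounded_pos)
  have bound: "norm (Dwf w y) \<le> \<zeta>Df y" if "w \<in> B ` ?D" for w y using that Dwf_bound by auto
  have K_compact: "compact (?K c)" for c
    using bounded_subset[OF dom_bounded sublevel_subset_dom]
    by (intro compact_Times compact_operator_image_compact B_compact closed_sublevel convex_sublevel
        psi_closed psi_convex Z_compact)
  have Dwf_z_meas: "(\<lambda>y. blinfun_apply (Dwf w y) z) \<in> borel_measurable borel" if "w \<in> B ` ?D" for w z
    using borel_measurable_continuous_onI[OF linear_continuous_on[OF blinfun.bounded_linear_left]]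
    by (rule measurable_compose[OF Dwf_meas[OF that]])
  have DF_eq: "blinfun_apply (DF w) z = (\<integral>y. blinfun_apply (Dwf w y) z \<partial>?Q)" if w: "w \<in> B ` ?D" for w z
  proof -
    have "\<zeta>Df \<in> borel_measurable borel" using borel_measurable_integrable[OF \<zeta>Df_int] by simp
    then have "integrable M (\<lambda>\<omega>. \<zeta>Df (\<xi> \<omega>))" using integrable_distr_eq[OF \<xi>_meas] \<zeta>Df_int by blast
    then have "blinfun_apply (DF w) z = (\<integral>\<omega>. blinfun_apply (Dwf w (\<xi> \<omega>)) z \<partial>M)"
      unfolding DF_def[OF w] using bound[OF w]
      by (intro dual_expectation_apply measurable_compose[OF \<xi>_meas Dwf_meas[OF w]])
    then show ?thesis using integral_distr[OF \<xi>_meas Dwf_z_meas[OF w]] by simp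
  qed
  have DFhat_eq: "blinfun_apply (DFhat N \<omega> w) z = ?A (\<lambda>y. blinfun_apply (Dwf w y) z) N \<omega>"
    if "w \<in> B ` ?D" for N \<omega> w z
    unfolding DFhat_def[OF that] by (simp add: blinfun.scaleR_left blinfun.sum_left)
  have cont: "continuous_on (?K c) (\<lambda>k. blinfun_apply (Dwf (fst k) y) (snd k))" for c y
  proof (intro bounded_bilinear.continuous_on[OF bounded_bilinear_blinfun_apply] continuous_on_snd continuous_on_id)
    show "continuous_on (?K c) (\<lambda>k. Dwf (fst k) y)"
      by (rule continuous_on_compose2[OF Dwf_cont[of y] continuous_on_fst[OF continuous_on_id]])
         (use K_D in force)
  qed
  have "AE \<omega> in M. uniform_limit (?K c) (\<lambda>N k. ?A (\<lambda>y. blinfun_apply (Dwf (fst k) y) (snd k)) N \<omega>)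
          (\<lambda>k. \<integral>y. blinfun_apply (Dwf (fst k) y) (snd k) \<partial>?Q) sequentially" for c
  proof (rule uniform_law_of_large_numbers[where \<zeta>="\<lambda>y. \<zeta>Df y * bZ", OF \<xi>s_indep \<xi>s_distr K_compact cont])
    show "integrable ?Q (\<lambda>y. \<zeta>Df y * bZ)" using \<zeta>Df_int by simp
    fix k assume k: "k \<in> ?K c"
    then have w: "fst k \<in> B ` ?D" using K_D[of "fst k" "snd k" c] by simp
    show "(\<lambda>y. blinfun_apply (Dwf (fst k) y) (snd k)) \<in> borel_measurable ?Q"
      using Dwf_z_meas[OF w] by simp
    show "\<bar>blinfun_apply (Dwf (fst k) y) (snd k)\<bar> \<le> \<zeta>Df y * bZ" for y
    proof -
      have "\<bar>blinfun_apply (Dwf (fst k) y) (snd k)\<bar> \<le> norm (Dwf (fst k) y) * norm (snd k)"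
        using norm_blinfun[of "Dwf (fst k) y" "snd k"] by simp
      also have "\<dots> \<le> \<zeta>Df y * bZ"
        using bound[OF w] bZ(1)[of "snd k"] k \<zeta>Df_nonneg by (intro mult_mono) auto
      finally show ?thesis .
    qed
  qed
  then have AE_unif: "AE \<omega> in M. \<forall>c. uniform_limit (?K c) (\<lambda>N k. ?A (\<lambda>y. blinfun_apply (Dwf (fst k) y) (snd k)) N \<omega>)
          (\<lambda>k. \<integral>y. blinfun_apply (Dwf (fst k) y) (snd k) \<partial>?Q) sequentially"
    unfolding AE_all_countable by blast
  \<comment> \<open>The averages of the dominating function converge, hence are bounded at almost
    every outcome; this is the origin of the constant \<open>b\<close> in the pathwise
    lemma.\<close>
  have AE_\<zeta>: "AE \<omega> in M. (\<lambda>N. ?A \<zeta>Df N \<omega>) \<longlonglongrightarrow> (\<integral>y. \<zeta>Df y \<partial>?Q)"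
    by (rule strong_law_sample_average[OF \<xi>s_indep \<xi>s_distr \<zeta>Df_int])
  have AE_gap: "AE \<omega> in M. \<forall>N. N \<ge> 1 \<longrightarrow> gap \<psi> (Bstar (DFhat N \<omega> (B (ubar N \<omega>)))) (ubar N \<omega>) \<le> ereal (\<epsilon> N)"
    unfolding AE_all_countable using ubar_gap by (auto intro!: AE_impI)
  \<comment> \<open>Both claims hold on one event of full measure, so they are proved jointly and
    separated only at the end.\<close>
  have "AE \<omega> in M. (\<lambda>N. gap \<psi> (Bstar (DF (B (ubar N \<omega>)))) (ubar N \<omega>)) \<longlonglongrightarrow> 0
      \<and> (\<exists>u. weak_accumulation_point (\<lambda>N. ubar N \<omega>) u)
      \<and> (\<forall>u. weak_accumulation_point (\<lambda>N. ubar N \<omega>) u \<longrightarrow>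
               u \<in> ?D \<and> gap \<psi> (Bstar (DF (B u))) u = 0)"
    using AE_unif AE_\<zeta> AE_gap AE_space
  proof eventually_elim
    fix \<omega>
    assume unif: "\<forall>c. uniform_limit (?K c) (\<lambda>N k. ?A (\<lambda>y. blinfun_apply (Dwf (fst k) y) (snd k)) N \<omega>)
          (\<lambda>k. \<integral>y. blinfun_apply (Dwf (fst k) y) (snd k) \<partial>?Q) sequentially"
      and \<zeta>: "(\<lambda>N. ?A \<zeta>Df N \<omega>) \<longlonglongrightarrow> (\<integral>y. \<zeta>Df y \<partial>?Q)"
      and gap: "\<forall>N. N \<ge> 1 \<longrightarrow> gap \<psi> (Bstar (DFhat N \<omega> (B (ubar N \<omega>)))) (ubar N \<omega>) \<le> ereal (\<epsilon> N)"
      and \<omega>: "\<omega> \<in> space M"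
    have lim: "uniform_limit (?K c) (\<lambda>N (w, z). blinfun_apply (DFhat N \<omega> w) z) (\<lambda>(w, z). blinfun_apply (DF w) z) sequentially" for c
      using unif[rule_format, of c]
      by (rule uniform_limit_cong'[THEN iffD1, rotated 2]) (use K_D[of _ _ c] in \<open>auto simp: DFhat_eq DF_eq\<close>)
    \<comment> \<open>Continuity of the limiting pairing is read off at this outcome, as a uniform
      limit of continuous sample averages; the conclusion itself does not involve \<omega>.\<close>
    have "continuous_on (?K c) (\<lambda>k. \<integral>y. blinfun_apply (Dwf (fst k) y) (snd k) \<partial>?Q)" for c
      by (rule uniform_limit_theorem[OF _ unif[rule_format]])
         (auto intro!: always_eventually continuous_on_mult_left continuous_on_sum cont simp del: times_divide_eq_left mult_1)
    then have DF_cont: "continuous_on (?K c) (\<lambda>(w, z). blinfun_apply (DF w) z)" for c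
      by (rule continuous_on_cong[OF refl, THEN iffD1, rotated]) (use K_D[of _ _ c] in \<open>auto simp: DF_eq\<close>)
    obtain b where b: "\<And>N. \<bar>?A \<zeta>Df N \<omega>\<bar> \<le> b"
      using convergent_imp_bounded[OF \<zeta>] by (auto simp: bounded_iff)
    have DFhat_bound: "norm (DFhat N \<omega> w) \<le> b" if w: "w \<in> B ` ?D" for N w
    proof -
      have "norm (DFhat N \<omega> w) = (1 / real N) * norm (\<Sum>i\<in>{1..N}. Dwf w (\<xi>s i \<omega>))"
        unfolding DFhat_def[OF w] by simp
      also have "\<dots> \<le> ?A \<zeta>Df N \<omega>"
        using bound[OF w] by (intro mult_left_mono sum_norm_le) auto
      finally show ?thesis using b[of N] by linarith
    qed
    note gap_consistency_tendsto gap_consistency_exists gap_consistency_zero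
    note this = this[where B=B and Bstar=Bstar and \<psi>=\<psi> and G="\<lambda>N. DFhat N \<omega>" and Ginf=DF and x="\<lambda>N. ubar N \<omega>",
        OF B_compact Bstar_adjoint psi_nonneg psi_proper psi_closed psi_convex dom_bounded
        DFhat_bound lim DF_cont \<epsilon>_lim ubar_dom[OF _ \<omega>] gap[rule_format]]
    then show "(\<lambda>N. gap \<psi> (Bstar (DF (B (ubar N \<omega>)))) (ubar N \<omega>)) \<longlonglongrightarrow> 0
      \<and> (\<exists>u. weak_accumulation_point (\<lambda>N. ubar N \<omega>) u)
      \<and> (\<forall>u. weak_accumulation_point (\<lambda>N. ubar N \<omega>) u \<longrightarrow>
               u \<in> ?D \<and> gap \<psi> (Bstar (DF (B u))) u = 0)"
      by blast
  qed
  then show ?thesis by auto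
qed

end
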